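(* Assume that conditions $\mathbf{A}$, $\mathbf{B}$, $\mathbf{C}$ stated in the context hold, let $\delta$ be as in the context, let $k\ge 0$ be an integer, and assume that the perturbation condition $\mathbf{P}_k^*$ stated in the context holds for some real $\rho<\delta$. Let $j\in\{1,\dots,N\}$. Then, as $\varepsilon\to 0$: (i) The following asymptotic expansion holds: $$\mathsf{\Phi}_j^{(\varepsilon)}(\rho)=\mathsf{\Phi}_j[\rho,0,0]+\mathsf{\Phi}_j[\rho,0,1]\varepsilon+\cdots+\mathsf{\Phi}_j[\rho,0,k]\varepsilon^k+\mathbf{o}(\varepsilon^k),$$ where $\mathsf{\Phi}_j[\rho,0,0]=\mathsf{\Phi}_j^{(0)}(\rho)$ and $$\mathsf{\Phi}_j[\rho,0,n]=\sum_{q=0}^n {}_{j}\mathbf{U}[\rho,q]\,\mathbf{p}_j[\rho,0,n-q],\qquad n=1,\dots,k.$$ (ii) For $r=1,\dots,k$, the following asymptotic expansion holds: $$\mathsf{\Phi}_j^{(\varepsilon)}(\rho,r)=\mathsf{\Phi}_j[\rho,r,0]+\mathsf{\Phi}_j[\rho,r,1]\varepsilon+\cdots+\mathsf{\Phi}_j[\rho,r,k-r]\varepsilon^{k-r}+\mathbf{o}(\varepsilon^{k-r}),$$ where $\mathsf{\Phi}_j[\rho,r,0]=\mathsf{\Phi}_j^{(0)}(\rho,r)$, $$\mathsf{\Phi}_j[\rho,r,n]=\sum_{q=0}^n {}_{j}\mathbf{U}[\rho,q]\,\boldsymbol{\lambda}_j[\rho,r,n-q],\qquad n=1,\dots,k-r,$$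 and, for $t=0,\dots,k-r$, $$\boldsymbol{\lambda}_j[\rho,r,t]=\mathbf{p}_j[\rho,r,t]+\sum_{m=1}^r\binom{r}{m}\sum_{q=0}^t {}_{j}\mathbf{P}[\rho,m,q]\,\mathsf{\Phi}_j[\rho,r-m,t-q].$$
   Context: **Process.** Let $X=\{0,1,\dots,N\}$ with $N\ge 1$, and $\mathbb{N}=\{1,2,\dots\}$. For every $\varepsilon\ge 0$ let $(\eta_n^{(\varepsilon)},\kappa_n^{(\varepsilon)})$, $n=0,1,\dots$, be a discrete time Markov renewal process, i.e. a homogeneous Markov chain on $X\times\mathbb{N}$ whose transition probabilities do not depend on the current value of the second component: $Q_{ij}^{(\varepsilon)}(k)=\mathsf{P}\{\eta_{n+1}^{(\varepsilon)}=j,\ \kappa_{n+1}^{(\varepsilon)}=k\mid \eta_n^{(\varepsilon)}=i,\ \kappa_n^{(\varepsilon)}=l\}$, and put $Q_{ij}^{(\varepsilon)}(0)=0$. Let $p_{ij}^{(\varepsilon)}=\sum_{k\ge1}Q_{ij}^{(\varepsilon)}(k)$ be the transition probabilities of the embedded chain $\eta_n^{(\varepsilon)}$, and write $Q_{ij}^{(\varepsilon)}(k)=p_{ij}^{(\varepsilon)}f_{ij}^{(\varepsilon)}(k)$, where $f_{ij}^{(\varepsilon)}(k)=\mathsf{P}\{\kappa_{n+1}^{(\varepsilon)}=k\mid\eta_n^{(\varepsilon)}=i,\eta_{n+1}^{(\varepsilon)}=j\}$ is a (proper) probability distribution on $\mathbb{N}$. Let $\tau^{(\varepsilon)}(0)=0$,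 $\tau^{(\varepsilon)}(n)=\kappa_1^{(\varepsilon)}+\cdots+\kappa_n^{(\varepsilon)}$, $\nu^{(\varepsilon)}(n)=\max\{k:\tau^{(\varepsilon)}(k)\le n\}$, and let $\xi^{(\varepsilon)}(n)=\eta^{(\varepsilon)}_{\nu^{(\varepsilon)}(n)}$ be the associated semi-Markov process. First hitting times: $\nu_j^{(\varepsilon)}=\min\{n\ge1:\eta_n^{(\varepsilon)}=j\}$ and $\mu_j^{(\varepsilon)}=\tau^{(\varepsilon)}(\nu_j^{(\varepsilon)})$, with values in $\{1,2,\dots,\infty\}$. $\mathsf{P}_i,\mathsf{E}_i$ denote probability and expectation conditional on $\eta_0^{(\varepsilon)}=i$. **Functionals** (with $0^0=1$), for $\rho\in\mathbb{R}$, $r=0,1,\dots$, $i,j,s\in X$: $g_{ij}^{(\varepsilon)}(n)=\mathsf{P}_i\{\mu_j^{(\varepsilon)}=n,\ \nu_0^{(\varepsilon)}>\nu_j^{(\varepsilon)}\}$ for $n=0,1,\dots$, $g_{ij}^{(\varepsilon)}=\mathsf{P}_i\{\nu_0^{(\varepsilon)}>\nu_j^{(\varepsilon)}\}$, $\phi_{ij}^{(\varepsilon)}(\rho,r)=\sum_{n\ge0}n^re^{\rho n}g_{ij}^{(\varepsilon)}(n)$, $\phi_{ij}^{(\varepsilon)}(\rho)=\phi_{ij}^{(\varepsilon)}(\rho,0)$, $p_{ij}^{(\varepsilon)}(\rho,r)=\sum_{n\ge0}n^re^{\rho n}Q_{ij}^{(\varepsilon)}(n)$, $p_{ij}^{(\varepsilon)}(\rho)=p_{ij}^{(\varepsilon)}(\rho,0)$,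 $\omega_{ijs}^{(\varepsilon)}(\rho)=\sum_{n\ge0}e^{\rho n}\mathsf{P}_i\{\xi^{(\varepsilon)}(n)=s,\ \mu_0^{(\varepsilon)}\wedge\mu_j^{(\varepsilon)}>n\}$. **Conditions.** $\mathbf{A}$: (a) $p_{ij}^{(\varepsilon)}\to p_{ij}^{(0)}$ as $\varepsilon\to0$, for $i\ne0$, $j\in X$; (b) $f_{ij}^{(\varepsilon)}(n)\to f_{ij}^{(0)}(n)$ as $\varepsilon\to0$, for $n\in\mathbb{N}$, $i\ne0$, $j\in X$. $\mathbf{B}$: $g_{ij}^{(0)}>0$ for all $i,j\ne0$. $\mathbf{C}$: there exists $\beta>0$ such that (a) $\limsup_{0\le\varepsilon\to0}p_{ij}^{(\varepsilon)}(\beta)<\infty$ for all $i\ne0$, $j\in X$ (i.e. $p_{ij}^{(\varepsilon)}(\beta)$ is bounded for $\varepsilon\ge0$ small enough, including $\varepsilon=0$); (b) $\phi_{ii}^{(0)}(\beta_i)\in(1,\infty)$ for some $i\ne0$ and some $\beta_i\le\beta$. **The parameter $\delta$.** Under $\mathbf{A}$–$\mathbf{C}$ there exists $\delta\in(0,\beta]$ with the following properties, and $\delta$ denotes such a number: $\phi_{kj}^{(\varepsilon)}(\rho)\to\phi_{kj}^{(0)}(\rho)<\infty$ and $\omega_{kjs}^{(\varepsilon)}(\rho)\to\omega_{kjs}^{(0)}(\rho)<\infty$ as $\varepsilon\to0$ for all $\rho\le\delta$ and $k,j,s\ne0$; $\phi_{jj}^{(0)}(\delta)\in(1,\infty)$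 for $j\ne0$; for sufficiently small $\varepsilon$ the equation $\phi_{ii}^{(\varepsilon)}(\rho)=1$ has a unique non-negative root $\rho^{(\varepsilon)}$, independent of $i\neq 0$; and $\rho^{(\varepsilon)}\to\rho^{(0)}<\delta$. **Condition $\mathbf{P}_k^*$** (for a given $\rho<\delta$): for $r=0,\dots,k$, $i\ne0$, $j\in X$, $p_{ij}^{(\varepsilon)}(\rho,r)=p_{ij}^{(0)}(\rho,r)+p_{ij}[\rho,r,1]\varepsilon+\cdots+p_{ij}[\rho,r,k-r]\varepsilon^{k-r}+o(\varepsilon^{k-r})$ as $\varepsilon\to0$, with all coefficients $p_{ij}[\rho,r,n]$ finite. Put $p_{ij}[\rho,r,0]=p_{ij}^{(0)}(\rho,r)$. **Vectors and matrices** ($j\ne0$). $\mathsf{\Phi}_j^{(\varepsilon)}(\rho,r)=[\phi_{1j}^{(\varepsilon)}(\rho,r)\ \cdots\ \phi_{Nj}^{(\varepsilon)}(\rho,r)]^T$, $\mathsf{\Phi}_j^{(\varepsilon)}(\rho)=\mathsf{\Phi}_j^{(\varepsilon)}(\rho,0)$; $\mathbf{p}_j[\rho,r,n]=[p_{1j}[\rho,r,n]\ \cdots\ p_{Nj}[\rho,r,n]]^T$. ${}_j\mathbf{P}^{(\varepsilon)}(\rho)$ is the $N\times N$ matrix with $(i,k)$ entry $p_{ik}^{(\varepsilon)}(\rho)$ if $k\ne j$ and $0$ if $k=j$; ${}_j\mathbf{P}[\rho,r,n]$ is the $N\times N$ matrix with $(i,k)$ entry $p_{ik}[\rho,r,n]$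 if $k\ne j$ and $0$ if $k=j$ ($i,k\in\{1,\dots,N\}$). The matrices ${}_j\mathbf{U}[\rho,n]$ are defined by ${}_j\mathbf{U}[\rho,0]=(\mathbf{I}-{}_j\mathbf{P}^{(0)}(\rho))^{-1}$ (the inverse exists under $\mathbf{A}$–$\mathbf{C}$ for $\rho\le\delta$) and ${}_j\mathbf{U}[\rho,n]={}_j\mathbf{U}[\rho,0]\sum_{q=1}^n{}_j\mathbf{P}[\rho,0,q]\,{}_j\mathbf{U}[\rho,n-q]$ for $n=1,\dots,k$. $\mathbf{o}(\varepsilon^p)$ denotes a matrix- (or vector-) valued function of $\varepsilon$ all of whose elements are $o(\varepsilon^p)$ as $\varepsilon\to0$. *)

theory Defs
  imports "HOL-Probability.Probability" "HOL-Library.Landau_Symbols"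
begin

section \<open>Discrete time semi-Markov processes\<close>

text \<open>
  The state space \<open>{0,1,\<dots>,N}\<close> is \<^typ>\<open>'n option\<close> for a finite (nonempty) type \<^typ>\<open>'n\<close>
  with \<open>N\<close> elements: the state \<open>0\<close> is \<^term>\<open>None\<close>, and the states \<open>1,\<dots>,N\<close> are the
  \<^term>\<open>Some i\<close>.  Vectors and matrices indexed by \<open>{1,\<dots>,N}\<close> are thus indexed by \<^typ>\<open>'n\<close>.
\<close>

type_synonym 'n state = "'n option"

text \<open>
  \<open>law X i\<close> is the probability \<open>P\<^sub>i\<close> given that the initial state is \<open>i\<close>;
  \<open>trans_prob X i j k\<close> is \<open>Q\<^sub>i\<^sub>j(k)\<close> and \<open>sojourn_dist X i j k\<close> is \<open>f\<^sub>i\<^sub>j(k)\<close>.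
\<close>

record ('w, 'n) renewal_process =
  law :: "'n state \<Rightarrow> 'w measure"
  eta :: "nat \<Rightarrow> 'w \<Rightarrow> 'n state"
  kappa :: "nat \<Rightarrow> 'w \<Rightarrow> nat"
  trans_prob :: "'n state \<Rightarrow> 'n state \<Rightarrow> nat \<Rightarrow> real"
  sojourn_dist :: "'n state \<Rightarrow> 'n state \<Rightarrow> nat \<Rightarrow> real"

definition embedded_prob :: "('w, 'n) renewal_process \<Rightarrow> 'n state \<Rightarrow> 'n state \<Rightarrow> real" where
  "embedded_prob X i j = (\<Sum>k. trans_prob X i j k)"

text \<open>
  The Markov property is stated for all histories \<open>(x\<^sub>0,y\<^sub>0),\<dots>,(x\<^sub>n,y\<^sub>n)\<close> of positive probability.
  If \<open>p\<^sub>i\<^sub>j = 0\<close>, then \<open>f\<^sub>i\<^sub>j\<close> may be any proper distribution on \<open>{1,2,\<dots>}\<close>; otherwise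
  \<open>Q\<^sub>i\<^sub>j = p\<^sub>i\<^sub>j f\<^sub>i\<^sub>j\<close> forces it to be the conditional distribution of the transition time.
\<close>

definition markov_renewal :: "('w, 'n::finite) renewal_process \<Rightarrow> bool" where
  "markov_renewal X \<longleftrightarrow>
     (\<forall>i. prob_space (law X i)) \<and>
     (\<forall>i n. eta X n \<in> law X i \<rightarrow>\<^sub>M count_space UNIV) \<and>
     (\<forall>i n. kappa X n \<in> law X i \<rightarrow>\<^sub>M count_space UNIV) \<and>
     (\<forall>i n. \<forall>\<omega>\<in>space (law X i). 1 \<le> kappa X n \<omega>) \<and>
     (\<forall>i. \<P>(\<omega> in law X i. eta X 0 \<omega> = i) = 1) \<and>
     (\<forall>i n x y j k.
        \<P>(\<omega> in law X i. \<forall>m\<le>n. eta X m \<omega> = x m \<and> kappa X m \<omega> = y m) > 0 \<longrightarrow>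
        \<P>(\<omega> in law X i. eta X (Suc n) \<omega> = j \<and> kappa X (Suc n) \<omega> = k
             \<bar> \<forall>m\<le>n. eta X m \<omega> = x m \<and> kappa X m \<omega> = y m) = trans_prob X (x n) j k) \<and>
     (\<forall>i j. trans_prob X i j 0 = 0) \<and>
     (\<forall>i j k. trans_prob X i j k = embedded_prob X i j * sojourn_dist X i j k) \<and>
     (\<forall>i j k. 0 \<le> sojourn_dist X i j k) \<and>
     (\<forall>i j. sojourn_dist X i j 0 = 0) \<and>
     (\<forall>i j. sojourn_dist X i j sums 1)"

definition tau :: "('w, 'n) renewal_process \<Rightarrow> nat \<Rightarrow> 'w \<Rightarrow> nat" where
  "tau X n \<omega> = (\<Sum>m=1..n. kappa X m \<omega>)"

definition semi_markov :: "('w, 'n) renewal_process \<Rightarrow> nat \<Rightarrow> 'w \<Rightarrow> 'n state" where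
  "semi_markov X n \<omega> = eta X (Max {k. tau X k \<omega> \<le> n}) \<omega>"

text \<open>The infimum over the empty set is \<^term>\<open>\<infinity> :: enat\<close>.\<close>

definition hit_step :: "('w, 'n) renewal_process \<Rightarrow> 'n state \<Rightarrow> 'w \<Rightarrow> enat" where
  "hit_step X j \<omega> = (INF n\<in>{n. 1 \<le> n \<and> eta X n \<omega> = j}. enat n)"

definition hit_time :: "('w, 'n) renewal_process \<Rightarrow> 'n state \<Rightarrow> 'w \<Rightarrow> enat" where
  "hit_time X j \<omega> =
     (case hit_step X j \<omega> of enat n \<Rightarrow> enat (tau X n \<omega>) | \<infinity> \<Rightarrow> \<infinity>)"


section \<open>Exponential moment functionals\<close>

definition g_at :: "('w, 'n) renewal_process \<Rightarrow> 'n state \<Rightarrow> 'n state \<Rightarrow> nat \<Rightarrow> real" where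
  "g_at X i j n =
     \<P>(\<omega> in law X i. hit_time X j \<omega> = enat n \<and> hit_step X None \<omega> > hit_step X j \<omega>)"

definition g_tot :: "('w, 'n) renewal_process \<Rightarrow> 'n state \<Rightarrow> 'n state \<Rightarrow> real" where
  "g_tot X i j = \<P>(\<omega> in law X i. hit_step X None \<omega> > hit_step X j \<omega>)"

text \<open>
  All series below have nonnegative terms and may diverge, hence are \<^typ>\<open>ennreal\<close>-valued.
  The last two arguments of \<open>phi\<close> and \<open>p_mom\<close> are \<open>\<rho>\<close> and \<open>r\<close>.
\<close>

definition phi :: "('w, 'n) renewal_process \<Rightarrow> 'n state \<Rightarrow> 'n state \<Rightarrow> real \<Rightarrow> nat \<Rightarrow> ennreal" where
  "phi X i j \<rho> r = (\<Sum>n. ennreal (real n ^ r * exp (\<rho> * real n) * g_at X i j n))"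

definition p_mom :: "('w, 'n) renewal_process \<Rightarrow> 'n state \<Rightarrow> 'n state \<Rightarrow> real \<Rightarrow> nat \<Rightarrow> ennreal" where
  "p_mom X i j \<rho> r = (\<Sum>n. ennreal (real n ^ r * exp (\<rho> * real n) * trans_prob X i j n))"

definition omega ::
  "('w, 'n) renewal_process \<Rightarrow> 'n state \<Rightarrow> 'n state \<Rightarrow> 'n state \<Rightarrow> real \<Rightarrow> ennreal" where
  "omega X i j s \<rho> =
     (\<Sum>n. ennreal (exp (\<rho> * real n) *
        \<P>(\<omega> in law X i. semi_markov X n \<omega> = s \<and> min (hit_time X None \<omega>) (hit_time X j \<omega>) > enat n)))"


section \<open>Conditions on the perturbed family\<close>

text \<open>
  A family of processes is indexed by all reals, but only \<open>\<epsilon> \<ge> 0\<close> is ever used.  Limits are taken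
  along \<^term>\<open>at_right (0::real)\<close>; the filter \<open>near_zero\<close> of neighbourhoods of \<open>0\<close> in \<open>[0,\<infinity>)\<close>
  serves for statements about all sufficiently small \<open>\<epsilon> \<ge> 0\<close>, including \<open>\<epsilon> = 0\<close>.
\<close>

abbreviation near_zero :: "real filter" where
  "near_zero \<equiv> inf (nhds 0) (principal {0..})"

definition cond_A :: "(real \<Rightarrow> ('w, 'n) renewal_process) \<Rightarrow> bool" where
  "cond_A X \<longleftrightarrow>
     (\<forall>i j. ((\<lambda>\<epsilon>. embedded_prob (X \<epsilon>) (Some i) j) \<longlongrightarrow> embedded_prob (X 0) (Some i) j) (at_right 0)) \<and>
     (\<forall>n\<ge>1. \<forall>i j. ((\<lambda>\<epsilon>. sojourn_dist (X \<epsilon>) (Some i) j n)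
                       \<longlongrightarrow> sojourn_dist (X 0) (Some i) j n) (at_right 0))"

definition cond_B :: "(real \<Rightarrow> ('w, 'n) renewal_process) \<Rightarrow> bool" where
  "cond_B X \<longleftrightarrow> (\<forall>i j. g_tot (X 0) (Some i) (Some j) > 0)"

definition cond_C :: "(real \<Rightarrow> ('w, 'n) renewal_process) \<Rightarrow> real \<Rightarrow> bool" where
  "cond_C X \<beta> \<longleftrightarrow>
     \<beta> > 0 \<and>
     (\<forall>i j. Limsup near_zero (\<lambda>\<epsilon>. p_mom (X \<epsilon>) (Some i) j \<beta> 0) < \<infinity>) \<and>
     (\<exists>i. \<exists>\<beta>\<^sub>i\<le>\<beta>. 1 < phi (X 0) (Some i) (Some i) \<beta>\<^sub>i 0 \<and> phi (X 0) (Some i) (Some i) \<beta>\<^sub>i 0 < \<infinity>)"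

definition admissible_delta ::
  "(real \<Rightarrow> ('w, 'n) renewal_process) \<Rightarrow> real \<Rightarrow> real \<Rightarrow> bool" where
  "admissible_delta X \<beta> \<delta> \<longleftrightarrow>
     0 < \<delta> \<and> \<delta> \<le> \<beta> \<and>
     (\<forall>\<rho>\<le>\<delta>. \<forall>k j.
        phi (X 0) (Some k) (Some j) \<rho> 0 < \<infinity> \<and>
        ((\<lambda>\<epsilon>. phi (X \<epsilon>) (Some k) (Some j) \<rho> 0) \<longlongrightarrow> phi (X 0) (Some k) (Some j) \<rho> 0) (at_right 0)) \<and>
     (\<forall>\<rho>\<le>\<delta>. \<forall>k j s.
        omega (X 0) (Some k) (Some j) (Some s) \<rho> < \<infinity> \<and>
        ((\<lambda>\<epsilon>. omega (X \<epsilon>) (Some k) (Some j) (Some s) \<rho>)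
            \<longlongrightarrow> omega (X 0) (Some k) (Some j) (Some s) \<rho>) (at_right 0)) \<and>
     (\<forall>j. 1 < phi (X 0) (Some j) (Some j) \<delta> 0 \<and> phi (X 0) (Some j) (Some j) \<delta> 0 < \<infinity>) \<and>
     (\<exists>rho_root.
        (\<forall>\<^sub>F \<epsilon> in near_zero. 0 \<le> rho_root \<epsilon> \<and>
           (\<forall>i. \<forall>\<rho>\<ge>0. phi (X \<epsilon>) (Some i) (Some i) \<rho> 0 = 1 \<longleftrightarrow> \<rho> = rho_root \<epsilon>)) \<and>
        (rho_root \<longlongrightarrow> rho_root 0) (at_right 0) \<and> rho_root 0 < \<delta>)"

text \<open>
  \<open>F(\<epsilon>) = c\<^sub>0 + c\<^sub>1 \<epsilon> + \<dots> + c\<^sub>m \<epsilon>\<^sup>m + o(\<epsilon>\<^sup>m)\<close> with \<open>c\<^sub>0 = F(0)\<close>.  As the coefficients are real,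
  such an expansion entails that \<open>F(\<epsilon>)\<close> is finite for all small \<open>\<epsilon> \<ge> 0\<close>; this is made
  explicit since \<^const>\<open>enn2real\<close> maps \<open>\<infinity>\<close> to \<open>0\<close>.
\<close>

definition expands :: "(real \<Rightarrow> ennreal) \<Rightarrow> (nat \<Rightarrow> real) \<Rightarrow> nat \<Rightarrow> bool" where
  "expands F c m \<longleftrightarrow>
     (\<forall>\<^sub>F \<epsilon> in near_zero. F \<epsilon> < \<infinity>) \<and>
     c 0 = enn2real (F 0) \<and>
     (\<lambda>\<epsilon>. enn2real (F \<epsilon>) - (\<Sum>n\<le>m. c n * \<epsilon> ^ n)) \<in> o[at_right 0](\<lambda>\<epsilon>. \<epsilon> ^ m)"

definition vec_expands :: "(real \<Rightarrow> ennreal ^ 'n) \<Rightarrow> (nat \<Rightarrow> real ^ 'n) \<Rightarrow> nat \<Rightarrow> bool" where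
  "vec_expands F c m \<longleftrightarrow> (\<forall>i. expands (\<lambda>\<epsilon>. F \<epsilon> $ i) (\<lambda>n. c n $ i) m)"

text \<open>In \<open>cond_P X k \<rho> pc\<close>, the coefficient \<open>p\<^sub>i\<^sub>j[\<rho>,r,n]\<close> is \<open>pc i j r n\<close>.\<close>

definition cond_P ::
  "(real \<Rightarrow> ('w, 'n) renewal_process) \<Rightarrow> nat \<Rightarrow> real
     \<Rightarrow> ('n \<Rightarrow> 'n state \<Rightarrow> nat \<Rightarrow> nat \<Rightarrow> real) \<Rightarrow> bool" where
  "cond_P X k \<rho> pc \<longleftrightarrow>
     (\<forall>r\<le>k. \<forall>i j. expands (\<lambda>\<epsilon>. p_mom (X \<epsilon>) (Some i) j \<rho> r) (pc i j r) (k - r))"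


section \<open>Vectors, matrices and coefficients\<close>

definition Phi_vec ::
  "('w, 'n::finite) renewal_process \<Rightarrow> 'n \<Rightarrow> real \<Rightarrow> nat \<Rightarrow> ennreal ^ 'n" where
  "Phi_vec X j \<rho> r = (\<chi> i. phi X (Some i) (Some j) \<rho> r)"

definition P_mat :: "('w, 'n::finite) renewal_process \<Rightarrow> 'n \<Rightarrow> real \<Rightarrow> real ^ 'n ^ 'n" where
  "P_mat X j \<rho> = (\<chi> i k. if k = j then 0 else enn2real (p_mom X (Some i) (Some k) \<rho> 0))"

definition p_coef ::
  "('n::finite \<Rightarrow> 'n state \<Rightarrow> nat \<Rightarrow> nat \<Rightarrow> real) \<Rightarrow> 'n \<Rightarrow> nat \<Rightarrow> nat \<Rightarrow> real ^ 'n" where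
  "p_coef pc j r n = (\<chi> i. pc i (Some j) r n)"

definition P_coef ::
  "('n::finite \<Rightarrow> 'n state \<Rightarrow> nat \<Rightarrow> nat \<Rightarrow> real) \<Rightarrow> 'n \<Rightarrow> nat \<Rightarrow> nat \<Rightarrow> real ^ 'n ^ 'n" where
  "P_coef pc j r n = (\<chi> i k. if k = j then 0 else pc i (Some k) r n)"

text \<open>
  In the following, \<open>X\<^sub>0\<close> is the unperturbed process.  Under the conditions above,
  \<^term>\<open>mat 1 - P_mat X\<^sub>0 j \<rho>\<close> is invertible for \<open>\<rho> \<le> \<delta>\<close>; otherwise \<^const>\<open>matrix_inv\<close>
  is an unspecified matrix.
\<close>

fun U_coef ::
  "('w, 'n::finite) renewal_process \<Rightarrow> real \<Rightarrow> ('n \<Rightarrow> 'n state \<Rightarrow> nat \<Rightarrow> nat \<Rightarrow> real)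
     \<Rightarrow> 'n \<Rightarrow> nat \<Rightarrow> real ^ 'n ^ 'n" where
  "U_coef X\<^sub>0 \<rho> pc j 0 = matrix_inv (mat 1 - P_mat X\<^sub>0 j \<rho>)"
| "U_coef X\<^sub>0 \<rho> pc j (Suc n) =
     matrix_inv (mat 1 - P_mat X\<^sub>0 j \<rho>) **
       (\<Sum>q=1..Suc n. P_coef pc j 0 q ** U_coef X\<^sub>0 \<rho> pc j (Suc n - q))"

function
  Phi_coef ::
    "('w, 'n::finite) renewal_process \<Rightarrow> real \<Rightarrow> ('n \<Rightarrow> 'n state \<Rightarrow> nat \<Rightarrow> nat \<Rightarrow> real)
       \<Rightarrow> 'n \<Rightarrow> nat \<Rightarrow> nat \<Rightarrow> real ^ 'n"
  and lambda_coef ::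
    "('w, 'n::finite) renewal_process \<Rightarrow> real \<Rightarrow> ('n \<Rightarrow> 'n state \<Rightarrow> nat \<Rightarrow> nat \<Rightarrow> real)
       \<Rightarrow> 'n \<Rightarrow> nat \<Rightarrow> nat \<Rightarrow> real ^ 'n"
where
  "Phi_coef X\<^sub>0 \<rho> pc j r n =
     (if n = 0 then \<chi> i. enn2real (Phi_vec X\<^sub>0 j \<rho> r $ i)
      else if r = 0 then \<Sum>q\<le>n. U_coef X\<^sub>0 \<rho> pc j q *v p_coef pc j 0 (n - q)
      else \<Sum>q\<le>n. U_coef X\<^sub>0 \<rho> pc j q *v lambda_coef X\<^sub>0 \<rho> pc j r (n - q))"
| "lambda_coef X\<^sub>0 \<rho> pc j r t =
     p_coef pc j r t +
     (\<Sum>m=1..r. real (r choose m) *\<^sub>R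
        (\<Sum>q\<le>t. P_coef pc j m q *v Phi_coef X\<^sub>0 \<rho> pc j (r - m) (t - q)))"
  by pat_completeness auto
termination
  by (relation "Wellfounded.measure (\<lambda>x. case x of Inl (X\<^sub>0, \<rho>, pc, j, r, n) \<Rightarrow> 2 * r + 1
                                     | Inr (X\<^sub>0, \<rho>, pc, j, r, t) \<Rightarrow> 2 * r)") auto

declare Phi_coef.simps [simp del] lambda_coef.simps [simp del]

end

theory Submission
  imports Defs
begin

text \<open>
  The exponential moments \<open>\<phi>\<^sub>i\<^sub>j(\<rho>, r)\<close> solve a finite linear system.  Decomposing a passage from \<open>i\<close> to \<open>j\<close>
  that avoids \<open>0\<close> according to its first transition gives the renewal equation
  \<open>g\<^sub>i\<^sub>j(n) = Q\<^sub>i\<^sub>j(n) + \<Sum>\<^sub>l \<Sum>\<^sub>k Q\<^sub>i\<^sub>l(k) g\<^sub>l\<^sub>j(n - k)\<close> with \<open>l \<noteq> 0, j\<close> (\<open>renewal_equation\<close>).  Multiplying by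
  \<open>n\<^sup>r e\<^sup>\<rho>\<^sup>n\<close>, summing over \<open>n\<close> and expanding \<open>n\<^sup>r\<close> by the binomial theorem yields
  \<open>\<Phi>(r) = \<lambda>(r) + P \<Phi>(r)\<close>, where \<open>P\<close> is the matrix of the \<open>p\<^sub>i\<^sub>l(\<rho>)\<close>, \<open>l \<noteq> j\<close>, and \<open>\<lambda>(r)\<close> involves the moments
  \<open>p(m)\<close> and the vectors \<open>\<Phi>(r - m)\<close> with \<open>1 \<le> m \<le> r\<close> (\<open>moment_renewal_equation\<close>).

  The unperturbed matrix \<open>I - P\<close> is invertible (\<open>invertible_1_minus_P_mat\<close>).  This follows from a maximum
  principle: \<open>\<Phi>\<close> itself is a positive finite solution of \<open>u = p\<^sub>j + P u\<close>, and by condition \<open>B\<close> the state \<open>j\<close> can be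
  reached from everywhere, so no nonzero vector is fixed by \<open>P\<close>.

  It remains to expand the solution of a linear system whose data have expansions
  (\<open>real_expands_solution\<close>).  The formal solution of the system is a power series whose truncation
  solves the true system up to \<open>o(\<epsilon>\<^sup>K)\<close>; as \<open>I - P\<close> stays close to an invertible matrix, the true
  solution differs from the truncation by \<open>o(\<epsilon>\<^sup>K)\<close> too.  The coefficients \<open>U[n]\<close> of the statement are
  those of the formal inverse of \<open>I - P\<close> (\<open>U_coef_recursion\<close>), so the given \<open>\<Phi>[r,n]\<close> are exactly the
  coefficients of the formal solution (\<open>resolvent_series_recursion\<close>).  The theorem follows by
  strong induction on \<open>r\<close>, because \<open>\<lambda>(r)\<close> contains \<open>\<Phi>\<close> only with smaller second argument.
  All \<open>\<phi>\<^sub>i\<^sub>j(\<rho>, r)\<close> are finite for small \<open>\<epsilon>\<close>, since \<open>\<phi>\<^sub>i\<^sub>j(\<delta>)\<close> is and \<open>\<rho> < \<delta>\<close> (\<open>phi_finite_moment\<close>).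
\<close>

section \<open>Path probabilities and the renewal equation\<close>

definition history :: "('w, 'n) renewal_process \<Rightarrow> nat \<Rightarrow> (nat \<Rightarrow> 'n state) \<Rightarrow> (nat \<Rightarrow> nat) \<Rightarrow> 'w \<Rightarrow> bool"
  where "history X a x y \<omega> \<longleftrightarrow> (\<forall>m\<le>a. eta X m \<omega> = x m \<and> kappa X m \<omega> = y m)"

text \<open>
  After step \<open>a\<close>, exactly \<open>m + 1\<close> further steps and \<open>n\<close> further time units are needed to reach
  \<open>Some j\<close>, and neither \<open>Some j\<close> nor \<open>None\<close> is visited on the way.  The recursion peels off the first
  step, which is the step that the Markov property controls once the history up to \<open>a\<close> is known.
\<close>

primrec passage :: "('w, 'n) renewal_process \<Rightarrow> 'n \<Rightarrow> nat \<Rightarrow> nat \<Rightarrow> nat \<Rightarrow> 'w \<Rightarrow> bool" where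
  "passage X j 0 a n \<omega> \<longleftrightarrow> eta X (Suc a) \<omega> = Some j \<and> kappa X (Suc a) \<omega> = n"
| "passage X j (Suc m) a n \<omega> \<longleftrightarrow>
     (\<exists>l\<in>-{j}. \<exists>k\<in>{..n}. eta X (Suc a) \<omega> = Some l \<and> kappa X (Suc a) \<omega> = k \<and>
        passage X j m (Suc a) (n - k) \<omega>)"

text \<open>
  The probability of such a passage from \<open>i\<close>, written as the sum over paths of products of transition
  probabilities.  It involves no law, so it can be compared between different initial states, each of
  which has its own probability measure.
\<close>

primrec passage_weight ::
  "('w, 'n::finite) renewal_process \<Rightarrow> 'n \<Rightarrow> nat \<Rightarrow> 'n state \<Rightarrow> nat \<Rightarrow> real" where
  "passage_weight X j 0 i n = trans_prob X i (Some j) n"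
| "passage_weight X j (Suc m) i n =
     (\<Sum>l\<in>-{j}. \<Sum>k\<le>n. trans_prob X i (Some l) k * passage_weight X j m (Some l) (n - k))"

lemma
  assumes "markov_renewal X"
  shows markov_renewal_prob_space: "prob_space (law X i)"
    and eta_measurable: "eta X n \<in> law X i \<rightarrow>\<^sub>M count_space UNIV"
    and kappa_measurable: "kappa X n \<in> law X i \<rightarrow>\<^sub>M count_space UNIV"
    and kappa_ge_1: "\<omega> \<in> space (law X i) \<Longrightarrow> 1 \<le> kappa X n \<omega>"
    and eta_0: "\<P>(\<omega> in law X i. eta X 0 \<omega> = i) = 1"
    and trans_prob_0: "trans_prob X i l 0 = 0"
proof -
  show "prob_space (law X i)"
    by (rule assms[unfolded markov_renewal_def, THEN conjunct1, THEN spec])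
  show "eta X n \<in> law X i \<rightarrow>\<^sub>M count_space UNIV"
    by (rule assms[unfolded markov_renewal_def, THEN conjunct2, THEN conjunct1, THEN spec, THEN spec])
  show "kappa X n \<in> law X i \<rightarrow>\<^sub>M count_space UNIV"
    by (rule assms[unfolded markov_renewal_def, THEN conjunct2, THEN conjunct2, THEN conjunct1, THEN spec, THEN spec])
  show "1 \<le> kappa X n \<omega>" if "\<omega> \<in> space (law X i)"
    by (rule assms[unfolded markov_renewal_def, THEN conjunct2, THEN conjunct2, THEN conjunct2, THEN conjunct1, THEN spec, THEN spec, THEN bspec]) (rule that)
  show "\<P>(\<omega> in law X i. eta X 0 \<omega> = i) = 1"
    by (rule assms[unfolded markov_renewal_def, THEN conjunct2, THEN conjunct2, THEN conjunct2, THEN conjunct2, THEN conjunct1, THEN spec])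
  show "trans_prob X i l 0 = 0"
    by (rule assms[unfolded markov_renewal_def, THEN conjunct2, THEN conjunct2, THEN conjunct2, THEN conjunct2, THEN conjunct2, THEN conjunct2, THEN conjunct1, THEN spec, THEN spec])
qed

lemma markov_property:
  assumes "markov_renewal X" "0 < \<P>(\<omega> in law X i. history X a x y \<omega>)"
  shows "\<P>(\<omega> in law X i. eta X (Suc a) \<omega> = l \<and> kappa X (Suc a) \<omega> = k \<bar> history X a x y \<omega>)
    = trans_prob X (x a) l k"
  using assms(2) unfolding history_def
  by (rule assms(1)[unfolded markov_renewal_def, THEN conjunct2, THEN conjunct2, THEN conjunct2, THEN conjunct2, THEN conjunct2, THEN conjunct1,
        THEN spec, THEN spec, THEN spec, THEN spec, THEN spec, THEN spec, THEN mp])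

lemma history_measurable:
  assumes "markov_renewal X"
  shows "Measurable.pred (law X i) (history X a x y)"
proof -
  note [measurable] = eta_measurable[OF assms] kappa_measurable[OF assms]
  show ?thesis unfolding history_def by measurable
qed

text \<open>
  Some history \<open>\<eta>\<^sub>0 = i, \<kappa>\<^sub>0 = y\<close> has positive probability, because countably many values \<open>y\<close> exhaust
  the space; the Markov property for this history identifies \<open>Q\<^sub>i\<^sub>l(k)\<close> with a probability.
\<close>

lemma trans_prob_nonneg:
  assumes "markov_renewal X"
  shows "0 \<le> trans_prob X i l k"
proof -
  interpret prob_space "law X i" by (rule markov_renewal_prob_space[OF assms])
  note [measurable] = eta_measurable[OF assms] kappa_measurable[OF assms] history_measurable[OF assms]
  let ?H = "\<lambda>y. history X 0 (\<lambda>_. i) (\<lambda>_. y)"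
  have "\<exists>y. \<P>(\<omega> in law X i. ?H y \<omega>) > 0"
  proof (rule ccontr)
    assume "\<nexists>y. \<P>(\<omega> in law X i. ?H y \<omega>) > 0"
    then have "\<P>(\<omega> in law X i. ?H y \<omega>) = 0" for y
      by (auto simp: zero_less_measure_iff)
    then have "AE \<omega> in law X i. \<not> ?H y \<omega>" for y
      by (subst (asm) prob_eq_0) auto
    then have "AE \<omega> in law X i. \<forall>y. \<not> ?H y \<omega>"
      unfolding AE_all_countable by blast
    moreover have "AE \<omega> in law X i. eta X 0 \<omega> = i"
      using eta_0[OF assms, of i] by (subst (asm) prob_eq_1) auto
    ultimately have "AE \<omega> in law X i. False"
      by eventually_elim (auto simp: history_def)
    then show False by simp
  qed
  then obtain y where "\<P>(\<omega> in law X i. ?H y \<omega>) > 0" by blast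
  then have "trans_prob X i l k =
      \<P>(\<omega> in law X i. eta X (Suc 0) \<omega> = l \<and> kappa X (Suc 0) \<omega> = k \<bar> ?H y \<omega>)"
    by (rule markov_property[OF assms, where x = "\<lambda>_. i", symmetric])
  then show ?thesis by (simp add: cond_prob_def)
qed

lemma passage_measurable:
  fixes X :: "('w, 'n::finite) renewal_process"
  assumes "markov_renewal X"
  shows "Measurable.pred (law X i) (passage X j m a n)"
proof (induction m arbitrary: a n)
  case 0
  note [measurable] = eta_measurable[OF assms] kappa_measurable[OF assms]
  show ?case unfolding passage.simps by measurable
next
  case (Suc m)
  note [measurable] = eta_measurable[OF assms] kappa_measurable[OF assms] Suc
  show ?case unfolding passage.simps by measurable
qed

text \<open>
  The Markov property in product form; a null history gives \<open>0 = 0\<close>.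
\<close>

lemma history_extend:
  assumes "markov_renewal X"
  shows "\<P>(\<omega> in law X i. history X a x y \<omega> \<and> eta X (Suc a) \<omega> = l \<and> kappa X (Suc a) \<omega> = k)
    = \<P>(\<omega> in law X i. history X a x y \<omega>) * trans_prob X (x a) l k"
proof -
  interpret prob_space "law X i" by (rule markov_renewal_prob_space[OF assms])
  note [measurable] = eta_measurable[OF assms] kappa_measurable[OF assms] history_measurable[OF assms]
  show ?thesis
  proof (cases "\<P>(\<omega> in law X i. history X a x y \<omega>) = 0")
    case True
    have "\<P>(\<omega> in law X i. history X a x y \<omega> \<and> eta X (Suc a) \<omega> = l \<and> kappa X (Suc a) \<omega> = k)
      \<le> \<P>(\<omega> in law X i. history X a x y \<omega>)"
      by (rule finite_measure_mono) auto
    with True show ?thesis by (simp add: measure_le_0_iff)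
  next
    case False
    then have pos: "\<P>(\<omega> in law X i. history X a x y \<omega>) > 0"
      by (simp add: zero_less_measure_iff)
    then have "\<P>(\<omega> in law X i. eta X (Suc a) \<omega> = l \<and> kappa X (Suc a) \<omega> = k \<bar> history X a x y \<omega>)
        = trans_prob X (x a) l k"
      by (rule markov_property[OF assms])
    then show ?thesis using pos
      by (simp add: cond_prob_def field_simps conj_commute conj_left_commute)
  qed
qed

text \<open>
  Induction on the number of steps.  A passage of total time \<open>n\<close> has a first sojourn of length
  \<open>k \<le> n\<close>, so only finitely many pairs \<open>(l, k)\<close> are possible for the first step; each of them extends
  the history by one entry, to which the induction hypothesis applies.
\<close>

lemma prob_history_passage:
  fixes X :: "('w, 'n::finite) renewal_process"
  assumes "markov_renewal X"
  shows "\<P>(\<omega> in law X i. history X a x y \<omega> \<and> passage X j m a n \<omega>)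
    = \<P>(\<omega> in law X i. history X a x y \<omega>) * passage_weight X j m (x a) n"
proof (induction m arbitrary: a x y n)
  case 0
  show ?case using history_extend[OF assms] by simp
next
  case (Suc m)
  interpret prob_space "law X i" by (rule markov_renewal_prob_space[OF assms])
  note [measurable] = eta_measurable[OF assms] kappa_measurable[OF assms]
    history_measurable[OF assms] passage_measurable[OF assms]
  define x' where "x' l = x(Suc a := Some l)" for l
  define y' where "y' k = y(Suc a := k)" for k
  have ext: "history X (Suc a) (x' l) (y' k) \<omega> \<longleftrightarrow>
      history X a x y \<omega> \<and> eta X (Suc a) \<omega> = Some l \<and> kappa X (Suc a) \<omega> = k" for l k \<omega>
    by (auto simp: history_def x'_def y'_def le_Suc_eq)
  let ?S = "\<lambda>l k. {\<omega>\<in>space (law X i). history X (Suc a) (x' l) (y' k) \<omega> \<and> passage X j m (Suc a) (n - k) \<omega>}"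
  have "{\<omega>\<in>space (law X i). history X a x y \<omega> \<and> passage X j (Suc m) a n \<omega>}
     = (\<Union>p\<in>(-{j})\<times>{..n}. ?S (fst p) (snd p))"
    by (auto simp: ext)
  then have "\<P>(\<omega> in law X i. history X a x y \<omega> \<and> passage X j (Suc m) a n \<omega>)
     = prob (\<Union>p\<in>(-{j})\<times>{..n}. ?S (fst p) (snd p))"
    by simp
  also have "\<dots> = (\<Sum>p\<in>(-{j})\<times>{..n}. prob (?S (fst p) (snd p)))"
    by (rule finite_measure_finite_Union) (auto simp: disjoint_family_on_def ext)
  also have "\<dots> = (\<Sum>(l,k)\<in>(-{j})\<times>{..n}. \<P>(\<omega> in law X i. history X a x y \<omega>)
      * (trans_prob X (x a) (Some l) k * passage_weight X j m (Some l) (n - k)))"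
    unfolding Suc
    by (intro sum.cong) (auto simp: x'_def ext[unfolded x'_def] history_extend[OF assms])
  also have "\<dots> = \<P>(\<omega> in law X i. history X a x y \<omega>) * passage_weight X j (Suc m) (x a) n"
    by (simp add: sum.cartesian_product[symmetric] sum_distrib_left)
  finally show ?case .
qed

text \<open>
  Under \<open>P\<^sub>i\<close> the histories of length one are \<open>\<eta>\<^sub>0 = i, \<kappa>\<^sub>0 = y\<close>.  Summing over \<open>y\<close> removes the
  unknown distribution of \<open>\<kappa>\<^sub>0\<close>.
\<close>

lemma prob_passage:
  fixes X :: "('w, 'n::finite) renewal_process"
  assumes "markov_renewal X"
  shows "\<P>(\<omega> in law X i. passage X j m 0 n \<omega>) = passage_weight X j m i n"
proof -
  interpret prob_space "law X i" by (rule markov_renewal_prob_space[OF assms])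
  note [measurable] = eta_measurable[OF assms] kappa_measurable[OF assms]
    history_measurable[OF assms] passage_measurable[OF assms]
  let ?H = "\<lambda>y. history X 0 (\<lambda>_. i) (\<lambda>_. y)"
  have hist: "?H y \<omega> \<longleftrightarrow> eta X 0 \<omega> = i \<and> kappa X 0 \<omega> = y" for y \<omega>
    by (simp add: history_def)
  have split: "(\<lambda>y. \<P>(\<omega> in law X i. ?H y \<omega> \<and> R \<omega>)) sums \<P>(\<omega> in law X i. R \<omega>)"
    if [measurable]: "Measurable.pred (law X i) R" for R
  proof -
    have "(\<lambda>y. \<P>(\<omega> in law X i. ?H y \<omega> \<and> R \<omega>)) sums
        prob (\<Union>y. {\<omega>\<in>space (law X i). ?H y \<omega> \<and> R \<omega>})"
      by (rule finite_measure_UNION) (auto simp: disjoint_family_on_def hist)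
    also have "prob (\<Union>y. {\<omega>\<in>space (law X i). ?H y \<omega> \<and> R \<omega>}) = \<P>(\<omega> in law X i. R \<omega>)"
    proof (rule finite_measure_eq_AE)
      have "AE \<omega> in law X i. eta X 0 \<omega> = i"
        using eta_0[OF assms, of i] by (subst (asm) prob_eq_1) auto
      then show "AE \<omega> in law X i. \<omega> \<in> (\<Union>y. {\<omega>\<in>space (law X i). ?H y \<omega> \<and> R \<omega>}) \<longleftrightarrow>
          \<omega> \<in> {\<omega>\<in>space (law X i). R \<omega>}"
        by eventually_elim (auto simp: hist)
    qed measurable
    finally show ?thesis .
  qed
  have "(\<lambda>y. \<P>(\<omega> in law X i. ?H y \<omega>)) sums 1"
    using split[of "\<lambda>_. True"] by (simp add: prob_space)
  then have "(\<lambda>y. \<P>(\<omega> in law X i. ?H y \<omega>) * passage_weight X j m i n) sums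
      (1 * passage_weight X j m i n)"
    by (rule sums_mult2)
  moreover have "(\<lambda>y. \<P>(\<omega> in law X i. ?H y \<omega>) * passage_weight X j m i n) sums
      \<P>(\<omega> in law X i. passage X j m 0 n \<omega>)"
    using split[OF passage_measurable[OF assms], of j m 0 n] by (simp add: prob_history_passage[OF assms])
  ultimately show ?thesis by (simp add: sums_iff)
qed

lemma passage_iff:
  fixes X :: "('w, 'n::finite) renewal_process"
  shows "passage X j m a n \<omega> \<longleftrightarrow> eta X (a + Suc m) \<omega> = Some j \<and>
     (\<forall>q\<in>{a+1..a+m}. eta X q \<omega> \<noteq> None \<and> eta X q \<omega> \<noteq> Some j) \<and>
     (\<Sum>q=a+1..a+Suc m. kappa X q \<omega>) = n"
proof (induction m arbitrary: a n)
  case 0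
  then show ?case by simp
next
  case (Suc m)
  have ball_insert: "(\<forall>q\<in>insert b A. R q) \<longleftrightarrow> R b \<and> (\<forall>q\<in>A. R q)" for b A and R :: "nat \<Rightarrow> bool"
    by simp
  have ivl: "{a+1..a+Suc m} = insert (Suc a) {Suc a + 1..Suc a + m}" by auto
  have sm: "(\<Sum>q=a+1..a+Suc (Suc m). kappa X q \<omega>) =
      kappa X (Suc a) \<omega> + (\<Sum>q=Suc a+1..Suc a+Suc m. kappa X q \<omega>)"
    by (subst sum.atLeast_Suc_atMost) auto
  have end_step: "a + Suc (Suc m) = Suc a + Suc m" by simp
  have first: "(\<exists>l\<in>-{j}. \<exists>k\<in>{..n}. eta X (Suc a) \<omega> = Some l \<and> kappa X (Suc a) \<omega> = k \<and> R (n - k))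
      \<longleftrightarrow> eta X (Suc a) \<omega> \<noteq> None \<and> eta X (Suc a) \<omega> \<noteq> Some j \<and>
         kappa X (Suc a) \<omega> \<le> n \<and> R (n - kappa X (Suc a) \<omega>)" for R
    by (cases "eta X (Suc a) \<omega>") auto
  define s where "s = (\<Sum>q=Suc a+1..Suc a+Suc m. kappa X q \<omega>)"
  have time: "kappa X (Suc a) \<omega> \<le> n \<and> s = n - kappa X (Suc a) \<omega> \<longleftrightarrow> kappa X (Suc a) \<omega> + s = n"
    by auto
  have "passage X j (Suc m) a n \<omega> \<longleftrightarrow> eta X (Suc a) \<omega> \<noteq> None \<and> eta X (Suc a) \<omega> \<noteq> Some j \<and>
      kappa X (Suc a) \<omega> \<le> n \<and> passage X j m (Suc a) (n - kappa X (Suc a) \<omega>) \<omega>"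
    unfolding passage.simps by (rule first)
  then show ?case
    unfolding Suc.IH sm ivl unfolding ball_insert end_step s_def[symmetric]
    using time by argo
qed

lemma hit_step_eq_iff:
  "hit_step X j \<omega> = enat m \<longleftrightarrow> 1 \<le> m \<and> eta X m \<omega> = j \<and> (\<forall>q\<in>{1..<m}. eta X q \<omega> \<noteq> j)"
proof
  let ?A = "{n. 1 \<le> n \<and> eta X n \<omega> = j}"
  assume h: "hit_step X j \<omega> = enat m"
  have "?A \<noteq> {}"
  proof
    assume "?A = {}"
    then have "hit_step X j \<omega> = \<infinity>" unfolding hit_step_def by (simp only: image_empty Inf_enat_def) simp
    with h show False by simp
  qed
  then have "hit_step X j \<omega> \<in> enat ` ?A"
    unfolding hit_step_def Inf_enat_def by (auto intro: LeastI)
  then have "m \<in> ?A" using h by auto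
  moreover have "eta X q \<omega> \<noteq> j" if "q \<in> {1..<m}" for q
  proof
    assume "eta X q \<omega> = j"
    then have "hit_step X j \<omega> \<le> enat q" unfolding hit_step_def using that by (intro INF_lower) auto
    then show False using h that by auto
  qed
  ultimately show "1 \<le> m \<and> eta X m \<omega> = j \<and> (\<forall>q\<in>{1..<m}. eta X q \<omega> \<noteq> j)" by auto
next
  assume "1 \<le> m \<and> eta X m \<omega> = j \<and> (\<forall>q\<in>{1..<m}. eta X q \<omega> \<noteq> j)"
  then have m: "1 \<le> m" "eta X m \<omega> = j" and first: "\<And>q. 1 \<le> q \<Longrightarrow> eta X q \<omega> = j \<Longrightarrow> m \<le> q"
    by (simp, simp) (metis atLeastLessThan_iff not_le \<open>1 \<le> m \<and> _\<close>)
  show "hit_step X j \<omega> = enat m"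
    unfolding hit_step_def using m by (intro antisym INF_lower INF_greatest) (auto intro: first)
qed

lemma less_hit_step_iff:
  "enat m < hit_step X j \<omega> \<longleftrightarrow> (\<forall>q\<in>{1..m}. eta X q \<omega> \<noteq> j)"
proof
  assume h: "enat m < hit_step X j \<omega>"
  show "\<forall>q\<in>{1..m}. eta X q \<omega> \<noteq> j"
  proof safe
    fix q assume "q \<in> {1..m}" "j = eta X q \<omega>"
    then have "hit_step X j \<omega> \<le> enat q" unfolding hit_step_def by (intro INF_lower) auto
    then show False using h \<open>q \<in> {1..m}\<close> by (meson atLeastAtMost_iff enat_ord_simps(1) leD order_trans)
  qed
next
  assume h: "\<forall>q\<in>{1..m}. eta X q \<omega> \<noteq> j"
  have "enat (Suc m) \<le> hit_step X j \<omega>"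
    unfolding hit_step_def
  proof (intro INF_greatest)
    fix q assume "q \<in> {n. 1 \<le> n \<and> eta X n \<omega> = j}"
    then have "\<not> q \<le> m" using h by auto
    then show "enat (Suc m) \<le> enat q" by simp
  qed
  then show "enat m < hit_step X j \<omega>"
    by (metis Suc_ile_eq)
qed

text \<open>
  Every sojourn lasts at least one time unit, so a passage of total time \<open>n\<close> has at most \<open>n\<close> steps
  and the existential quantifier is bounded.  This makes all later sums over path lengths finite.
\<close>

lemma hit_event_iff_passage:
  fixes X :: "('w, 'n::finite) renewal_process"
  assumes "markov_renewal X" "\<omega> \<in> space (law X i)"
  shows "hit_time X (Some j) \<omega> = enat n \<and> hit_step X (Some j) \<omega> < hit_step X None \<omega> \<longleftrightarrow>
    (\<exists>m\<le>n. passage X j m 0 n \<omega>)"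
proof -
  have tau: "n \<le> tau X n \<omega>" for n
    using sum_mono[of "{1..n}" "\<lambda>_. 1" "\<lambda>m. kappa X m \<omega>"] kappa_ge_1[OF assms]
    by (simp add: tau_def)
  have pass: "passage X j m 0 n \<omega> \<longleftrightarrow> hit_step X (Some j) \<omega> = enat (Suc m) \<and>
      enat (Suc m) < hit_step X None \<omega> \<and> tau X (Suc m) \<omega> = n" for m
  proof -
    have "{1..<Suc m} = {1..m}" "{1..Suc m} = insert (Suc m) {1..m}" by auto
    then show ?thesis
    unfolding passage_iff hit_step_eq_iff less_hit_step_iff tau_def by auto
  qed
  show ?thesis
  proof
    assume h: "hit_time X (Some j) \<omega> = enat n \<and> hit_step X (Some j) \<omega> < hit_step X None \<omega>"
    then obtain m where m: "hit_step X (Some j) \<omega> = enat m" "tau X m \<omega> = n"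
      by (auto simp: hit_time_def split: enat.splits)
    then have "m \<ge> 1" by (simp add: hit_step_eq_iff)
    then obtain m' where "m = Suc m'" by (cases m) auto
    with m h have "passage X j m' 0 n \<omega>" "m' \<le> n" unfolding pass using tau[of m] by auto
    then show "\<exists>m\<le>n. passage X j m 0 n \<omega>" by blast
  next
    assume "\<exists>m\<le>n. passage X j m 0 n \<omega>"
    then show "hit_time X (Some j) \<omega> = enat n \<and> hit_step X (Some j) \<omega> < hit_step X None \<omega>"
      unfolding pass by (auto simp: hit_time_def)
  qed
qed

lemma g_at_eq_sum_passage_weight:
  fixes X :: "('w, 'n::finite) renewal_process"
  assumes "markov_renewal X"
  shows "g_at X i (Some j) n = (\<Sum>m\<le>n. passage_weight X j m i n)"
proof -
  interpret prob_space "law X i" by (rule markov_renewal_prob_space[OF assms])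
  note [measurable] = passage_measurable[OF assms]
  have "g_at X i (Some j) n = prob (\<Union>m\<in>{..n}. {\<omega>\<in>space (law X i). passage X j m 0 n \<omega>})"
    unfolding g_at_def using hit_event_iff_passage[OF assms]
    by (intro arg_cong[where f = prob]) blast
  also have "\<dots> = (\<Sum>m\<le>n. \<P>(\<omega> in law X i. passage X j m 0 n \<omega>))"
  proof (rule finite_measure_finite_Union)
    have "m = m'" if "passage X j m 0 n \<omega>" "passage X j m' 0 n \<omega>" for m m' \<omega>
    proof (rule ccontr)
      assume "m \<noteq> m'"
      then have "Suc m \<in> {1..m'} \<or> Suc m' \<in> {1..m}" by auto
      then show False using that unfolding passage_iff by auto
    qed
    then show "disjoint_family_on (\<lambda>m. {\<omega>\<in>space (law X i). passage X j m 0 n \<omega>}) {..n}"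
      by (auto simp: disjoint_family_on_def)
  qed auto
  finally show ?thesis by (simp add: prob_passage[OF assms])
qed

lemma passage_weight_eq_0:
  fixes X :: "('w, 'n::finite) renewal_process"
  assumes "markov_renewal X" "n \<le> m"
  shows "passage_weight X j m i n = 0"
  using assms(2)
proof (induction m arbitrary: i n)
  case 0
  then show ?case by (simp add: trans_prob_0[OF assms(1)])
next
  case (Suc m)
  have "trans_prob X i (Some l) k * passage_weight X j m (Some l) (n - k) = 0" for l k
    using Suc by (cases k) (auto simp: trans_prob_0[OF assms(1)])
  then show ?case by (simp only: passage_weight.simps sum.neutral_const)
qed

text \<open>
  Conditioning on the first transition.  The recursion of \<^const>\<open>passage_weight\<close> is summed over the path
  length \<open>m\<close>; the ranges of \<open>m\<close> on the two sides differ, which is harmless since weights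
  with \<open>m \<ge> n\<close> vanish and \<open>Q\<^sub>i\<^sub>l(0) = 0\<close>.
\<close>

lemma renewal_equation:
  fixes X :: "('w, 'n::finite) renewal_process"
  assumes "markov_renewal X"
  shows "g_at X i (Some j) n = trans_prob X i (Some j) n +
    (\<Sum>l\<in>-{j}. \<Sum>k\<le>n. trans_prob X i (Some l) k * g_at X (Some l) (Some j) (n - k))"
proof -
  have g: "(\<Sum>m<n. trans_prob X i (Some l) k * passage_weight X j m (Some l) (n - k)) =
      trans_prob X i (Some l) k * g_at X (Some l) (Some j) (n - k)" if "k \<le> n" for l k
  proof (cases "k = 0")
    case True
    then show ?thesis by (simp add: trans_prob_0[OF assms])
  next
    case False
    have "(\<Sum>m<n. passage_weight X j m (Some l) (n - k)) = (\<Sum>m\<le>n-k. passage_weight X j m (Some l) (n - k))"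
      using False that by (intro sum.mono_neutral_right) (auto simp: passage_weight_eq_0[OF assms])
    then show ?thesis by (simp add: g_at_eq_sum_passage_weight[OF assms] sum_distrib_left[symmetric])
  qed
  have "g_at X i (Some j) n = passage_weight X j 0 i n + (\<Sum>m<n. passage_weight X j (Suc m) i n)"
    unfolding g_at_eq_sum_passage_weight[OF assms] by (rule sum.atMost_shift)
  also have "(\<Sum>m<n. passage_weight X j (Suc m) i n) =
     (\<Sum>l\<in>-{j}. \<Sum>k\<le>n. \<Sum>m<n. trans_prob X i (Some l) k * passage_weight X j m (Some l) (n - k))"
    unfolding passage_weight.simps
    by (rule trans[OF sum.swap], rule sum.cong[OF refl], rule sum.swap)
  finally show ?thesis using g by simp
qed

section \<open>The linear system for exponential moments\<close>

lemma suminf_ennreal_convolution: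
  fixes f :: "nat \<Rightarrow> nat \<Rightarrow> ennreal"
  shows "(\<Sum>n. \<Sum>k\<le>n. f k (n - k)) = (\<Sum>k. \<Sum>d. f k d)"
proof -
  define F where "F k n = (if k \<le> n then f k (n - k) else 0)" for k n
  have "(\<Sum>n. \<Sum>k\<le>n. f k (n - k)) = (\<Sum>n. \<Sum>k. F k n)"
  proof (intro suminf_cong)
    fix n
    have "(\<Sum>k. F k n) = (\<Sum>k\<le>n. F k n)"
      by (rule suminf_finite) (auto simp: F_def)
    then show "(\<Sum>k\<le>n. f k (n - k)) = (\<Sum>k. F k n)" by (simp add: F_def)
  qed
  also have "\<dots> = (\<Sum>k. \<Sum>n. F k n)"
    using nn_integral_fst_count_space[of "\<lambda>(n, k). F k n"] nn_integral_snd_count_space[of "\<lambda>(n, k). F k n"]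
    by (simp add: nn_integral_count_space_nat)
  also have "(\<lambda>k. \<Sum>n. F k n) = (\<lambda>k. \<Sum>d. f k d)"
  proof
    fix k
    have "(\<Sum>n. F k n) = (\<Sum>d. F k (d + k)) + (\<Sum>n<k. F k n)"
      by (rule suminf_offset) simp
    then show "(\<Sum>n. F k n) = (\<Sum>d. f k d)" by (simp add: F_def)
  qed
  finally show ?thesis .
qed

text \<open>
  The weight \<open>e\<^sup>\<rho>\<^sup>n\<close> is multiplicative along \<open>n = k + d\<close>, and the binomial theorem splits \<open>(k + d)\<^sup>r\<close>; this
  is where the binomial coefficients of the vectors \<open>\<lambda>\<^sub>j[\<rho>,r,t]\<close> originate.
\<close>

lemma ennreal_exp_moment_convolution:
  fixes a b :: "nat \<Rightarrow> real"
  assumes "\<And>n. 0 \<le> a n" "\<And>n. 0 \<le> b n"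
  shows "(\<Sum>n. ennreal (real n ^ r * exp (\<rho> * real n) * (\<Sum>k\<le>n. a k * b (n - k)))) =
    (\<Sum>m\<le>r. of_nat (r choose m) * (\<Sum>n. ennreal (real n ^ m * exp (\<rho> * real n) * a n)) *
       (\<Sum>n. ennreal (real n ^ (r - m) * exp (\<rho> * real n) * b n)))" (is "?L = ?R")
proof -
  define A where "A m k = ennreal (real k ^ m * exp (\<rho> * real k) * a k)" for m k
  define B where "B m k = ennreal (real k ^ m * exp (\<rho> * real k) * b k)" for m k
  have term_split: "ennreal (real n ^ r * exp (\<rho> * real n) * (a k * b (n - k))) =
      (\<Sum>m\<le>r. of_nat (r choose m) * A m k * B (r - m) (n - k))" if "k \<le> n" for n k
  proof -
    define d where "d = n - k"
    have n: "n = k + d" using that by (simp add: d_def)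
    have "real n ^ r = (\<Sum>m\<le>r. of_nat (r choose m) * real k ^ m * real d ^ (r - m))"
      unfolding n of_nat_add by (rule binomial_ring)
    then have "real n ^ r * exp (\<rho> * real n) * (a k * b d) =
       (\<Sum>m\<le>r. real (r choose m) * (real k ^ m * exp (\<rho> * real k) * a k) *
          (real d ^ (r - m) * exp (\<rho> * real d) * b d))"
      by (simp add: sum_distrib_left sum_distrib_right n distrib_left exp_add mult_ac)
    also have "ennreal \<dots> = (\<Sum>m\<le>r. of_nat (r choose m) * A m k * B (r - m) d)"
      using assms by (simp add: A_def B_def sum_ennreal[symmetric] ennreal_mult ennreal_of_nat_eq_real_of_nat)
    finally show ?thesis by (simp add: d_def)
  qed
  have "?L = (\<Sum>n. \<Sum>k\<le>n. \<Sum>m\<le>r. of_nat (r choose m) * A m k * B (r - m) (n - k))"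
  proof (intro suminf_cong)
    fix n
    have "ennreal (real n ^ r * exp (\<rho> * real n) * (\<Sum>k\<le>n. a k * b (n - k))) =
        (\<Sum>k\<le>n. ennreal (real n ^ r * exp (\<rho> * real n) * (a k * b (n - k))))"
      unfolding sum_distrib_left using assms by (intro sum_ennreal[symmetric]) auto
    also have "\<dots> = (\<Sum>k\<le>n. \<Sum>m\<le>r. of_nat (r choose m) * A m k * B (r - m) (n - k))"
      using term_split by (intro sum.cong) auto
    finally show "ennreal (real n ^ r * exp (\<rho> * real n) * (\<Sum>k\<le>n. a k * b (n - k))) = \<dots>" .
  qed
  also have "\<dots> = (\<Sum>k. \<Sum>d. \<Sum>m\<le>r. of_nat (r choose m) * A m k * B (r - m) d)"
    by (rule suminf_ennreal_convolution)
  also have "\<dots> = (\<Sum>m\<le>r. of_nat (r choose m) * (\<Sum>k. A m k) * (\<Sum>d. B (r - m) d))"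
    by (simp add: suminf_sum[OF summableI])
  finally show ?thesis by (simp add: A_def B_def)
qed

lemma g_at_nonneg: "0 \<le> g_at X i j n"
  by (simp add: g_at_def)

lemma moment_renewal_equation:
  fixes X :: "('w, 'n::finite) renewal_process"
  assumes "markov_renewal X"
  shows "phi X i (Some j) \<rho> r = p_mom X i (Some j) \<rho> r +
    (\<Sum>l\<in>-{j}. \<Sum>m\<le>r. of_nat (r choose m) * p_mom X i (Some l) \<rho> m * phi X (Some l) (Some j) \<rho> (r - m))"
proof -
  let ?w = "\<lambda>n. real n ^ r * exp (\<rho> * real n)"
  let ?Q = "\<lambda>l. trans_prob X i (Some l)" and ?g = "\<lambda>l. g_at X (Some l) (Some j)"
  have "ennreal (?w n * g_at X i (Some j) n) = ennreal (?w n * ?Q j n) +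
      (\<Sum>l\<in>-{j}. ennreal (?w n * (\<Sum>k\<le>n. ?Q l k * ?g l (n - k))))" for n
    unfolding renewal_equation[OF assms, of i j n]
    by (simp add: distrib_left sum_distrib_left[of "?w n" _ "-{j}"] sum_ennreal trans_prob_nonneg[OF assms]
      g_at_nonneg sum_nonneg flip: ennreal_plus)
  then show ?thesis
    unfolding phi_def p_mom_def
    by (simp add: suminf_add[OF summableI summableI, symmetric] suminf_sum[OF summableI]
      ennreal_exp_moment_convolution trans_prob_nonneg[OF assms] g_at_nonneg)
qed

lemma ennreal_sum_finite:
  fixes f :: "'a \<Rightarrow> ennreal"
  assumes "\<And>x. x \<in> A \<Longrightarrow> f x < \<infinity>"
  shows "sum f A < \<infinity>"
proof (cases "finite A")
  case True
  from this assms show ?thesis by (induction A) auto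
qed simp

lemma enn2real_sum:
  assumes "\<And>x. x \<in> A \<Longrightarrow> f x < \<infinity>"
  shows "enn2real (sum f A) = (\<Sum>x\<in>A. enn2real (f x))"
proof (cases "finite A")
  case True
  from this assms show ?thesis
    by (induction A) (auto simp: enn2real_plus ennreal_sum_finite[unfolded infinity_ennreal_def])
qed simp

text \<open>
  Lowering the exponent by \<open>\<delta> - \<rho> > 0\<close> pays for any power of \<open>n\<close>: with \<open>y = (\<delta> - \<rho>) n\<close>, the bound
  \<open>y\<^sup>r / r! \<le> e\<^sup>y\<close> gives \<open>n\<^sup>r e\<^sup>\<rho>\<^sup>n \<le> c e\<^sup>\<delta>\<^sup>n\<close>.
\<close>

lemma phi_finite_moment:
  assumes "phi X i j \<delta> 0 < \<infinity>" "\<rho> < \<delta>"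
  shows "phi X i j \<rho> r < \<infinity>"
proof -
  define c where "c = fact r / (\<delta> - \<rho>) ^ r"
  have c: "c > 0" using assms by (simp add: c_def)
  have "real n ^ r * exp (\<rho> * real n) \<le> c * exp (\<delta> * real n)" for n
  proof -
    define y where "y = (\<delta> - \<rho>) * real n"
    have y: "y \<ge> 0" using assms by (simp add: y_def)
    have "y ^ r /\<^sub>R fact r = (\<Sum>k\<in>{r}. y ^ k /\<^sub>R fact k)" by simp
    also have "\<dots> \<le> exp y"
      unfolding exp_def using y by (intro sum_le_suminf summable_exp_generic) auto
    finally have "y ^ r \<le> fact r * exp y" by (simp add: field_simps)
    then have "real n ^ r * (\<delta> - \<rho>) ^ r \<le> fact r * exp y"
      by (simp add: y_def power_mult_distrib mult.commute)
    then have "real n ^ r \<le> c * exp y"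
      using assms by (simp add: c_def pos_le_divide_eq)
    then have "real n ^ r * exp (\<rho> * real n) \<le> c * exp y * exp (\<rho> * real n)" by simp
    also have "\<dots> = c * exp (\<delta> * real n)" by (simp add: y_def exp_add[symmetric] algebra_simps)
    finally show ?thesis .
  qed
  then have "phi X i j \<rho> r \<le> (\<Sum>n. ennreal (c * (exp (\<delta> * real n) * g_at X i j n)))"
    unfolding phi_def
    by (intro suminf_le summableI ennreal_leI) (auto intro!: mult_right_mono simp: g_at_nonneg simp flip: mult.assoc)
  also have "\<dots> = ennreal c * phi X i j \<delta> 0"
    using c by (simp add: phi_def ennreal_mult g_at_nonneg)
  also have "\<dots> < \<infinity>" using assms by (simp add: ennreal_mult_less_top)
  finally show ?thesis .
qed

lemma moment_renewal_equation_real: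
  fixes X :: "('w, 'n::finite) renewal_process"
  assumes "markov_renewal X"
    and fin_p: "\<And>l m. m \<le> r \<Longrightarrow> p_mom X i (Some l) \<rho> m < \<infinity>"
    and fin_phi: "\<And>l m. m \<le> r \<Longrightarrow> phi X (Some l) (Some j) \<rho> m < \<infinity>"
  shows "enn2real (phi X i (Some j) \<rho> r) = enn2real (p_mom X i (Some j) \<rho> r) +
    (\<Sum>l\<in>-{j}. \<Sum>m\<le>r. real (r choose m) * enn2real (p_mom X i (Some l) \<rho> m) *
       enn2real (phi X (Some l) (Some j) \<rho> (r - m)))"
proof -
  have p_j: "p_mom X i (Some j) \<rho> r < \<infinity>" using fin_p by simp
  have fin: "of_nat (r choose m) * p_mom X i (Some l) \<rho> m * phi X (Some l) (Some j) \<rho> (r - m) < \<infinity>"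
    if "m \<le> r" for m l
    using fin_p[OF that, of l] fin_phi[of "r - m" l] by (simp add: ennreal_mult_less_top of_nat_less_top)
  have fin': "(\<Sum>m\<le>r. of_nat (r choose m) * p_mom X i (Some l) \<rho> m * phi X (Some l) (Some j) \<rho> (r - m)) < \<infinity>" for l
    using fin by (intro ennreal_sum_finite) simp
  have "enn2real (phi X i (Some j) \<rho> r) = enn2real (p_mom X i (Some j) \<rho> r) +
    enn2real (\<Sum>l\<in>-{j}. \<Sum>m\<le>r. of_nat (r choose m) * p_mom X i (Some l) \<rho> m * phi X (Some l) (Some j) \<rho> (r - m))"
    unfolding moment_renewal_equation[OF assms(1), of i j \<rho> r]
    by (rule enn2real_plus, use p_j in simp)
       (rule ennreal_sum_finite[OF fin', unfolded infinity_ennreal_def])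
  also have "enn2real (\<Sum>l\<in>-{j}. \<Sum>m\<le>r. of_nat (r choose m) * p_mom X i (Some l) \<rho> m * phi X (Some l) (Some j) \<rho> (r - m)) =
    (\<Sum>l\<in>-{j}. \<Sum>m\<le>r. enn2real (of_nat (r choose m) * p_mom X i (Some l) \<rho> m * phi X (Some l) (Some j) \<rho> (r - m)))"
    by (subst enn2real_sum, rule fin', intro sum.cong[OF refl] enn2real_sum fin) simp
  finally show ?thesis by (simp add: enn2real_mult)
qed

section \<open>Invertibility of the unperturbed system\<close>

lemma hit_event_measurable:
  fixes X :: "('w, 'n::finite) renewal_process"
  assumes "markov_renewal X"
  shows "{\<omega>\<in>space (law X i). hit_time X (Some j) \<omega> = enat n \<and> hit_step X None \<omega> > hit_step X (Some j) \<omega>}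
    \<in> sets (law X i)"
proof -
  note [measurable] = passage_measurable[OF assms]
  have "{\<omega>\<in>space (law X i). hit_time X (Some j) \<omega> = enat n \<and> hit_step X None \<omega> > hit_step X (Some j) \<omega>}
     = {\<omega>\<in>space (law X i). \<exists>m\<le>n. passage X j m 0 n \<omega>}"
    using hit_event_iff_passage[OF assms] by blast
  also have "\<dots> \<in> sets (law X i)" by measurable
  finally show ?thesis .
qed

lemma g_at_sums_g_tot:
  fixes X :: "('w, 'n::finite) renewal_process"
  assumes "markov_renewal X"
  shows "g_at X i (Some j) sums g_tot X i (Some j)"
proof -
  interpret prob_space "law X i" by (rule markov_renewal_prob_space[OF assms])
  let ?E = "\<lambda>n. {\<omega>\<in>space (law X i). hit_time X (Some j) \<omega> = enat n \<and> hit_step X None \<omega> > hit_step X (Some j) \<omega>}"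
  have "(\<lambda>n. prob (?E n)) sums prob (\<Union>n. ?E n)"
    using hit_event_measurable[OF assms]
    by (intro finite_measure_UNION) (auto simp: disjoint_family_on_def)
  also have "(\<Union>n. ?E n) = {\<omega>\<in>space (law X i). hit_step X None \<omega> > hit_step X (Some j) \<omega>}"
  proof -
    have "\<exists>n. hit_time X (Some j) \<omega> = enat n" if "hit_step X (Some j) \<omega> < hit_step X None \<omega>" for \<omega>
      using that by (cases "hit_step X (Some j) \<omega>") (auto simp: hit_time_def)
    then show ?thesis by blast
  qed
  finally show ?thesis unfolding g_at_def g_tot_def .
qed

lemma p_mom_eq_0_D:
  assumes "markov_renewal X" "p_mom X i l \<rho> 0 = 0"
  shows "trans_prob X i l n = 0"
proof -
  have "ennreal (exp (\<rho> * real n) * trans_prob X i l n) = 0"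
    using assms(2) unfolding p_mom_def by (subst (asm) suminf_eq_zero_iff) (auto simp: summableI)
  then have "exp (\<rho> * real n) * trans_prob X i l n \<le> 0" by (simp add: ennreal_eq_0_iff)
  then show ?thesis using trans_prob_nonneg[OF assms(1), of i l n]
    by (simp add: mult_le_0_iff)
qed

lemma phi_pos:
  assumes "markov_renewal X" "0 < g_tot X i (Some j)"
  shows "0 < phi X i (Some j) \<rho> 0"
proof (rule ccontr)
  assume "\<not> 0 < phi X i (Some j) \<rho> 0"
  then have *: "ennreal (exp (\<rho> * real n) * g_at X i (Some j) n) = 0" for n
    unfolding phi_def by (simp add: not_less suminf_eq_zero_iff summableI)
  have "exp (\<rho> * real n) * g_at X i (Some j) n \<le> 0" for n
    using *[of n] by (simp add: ennreal_eq_0_iff)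
  then have "g_at X i (Some j) n = 0" for n
    using g_at_nonneg[of X i "Some j" n] by (simp add: mult_le_0_iff antisym)
  then have "g_at X i (Some j) = (\<lambda>_. 0)" by auto
  then have "g_tot X i (Some j) = 0"
    using g_at_sums_g_tot[OF assms(1), of i j] by (simp add: sums_iff)
  then show False using assms(2) by simp
qed

text \<open>
  Strong induction on \<open>n\<close> in the renewal equation.  The summand \<open>k = 0\<close>, where the argument of \<open>g\<close> does
  not decrease, vanishes because \<open>Q\<^sub>i\<^sub>l(0) = 0\<close>.
\<close>

lemma g_at_eq_0_of_closed:
  fixes X :: "('w, 'n::finite) renewal_process"
  assumes X: "markov_renewal X"
    and no_exit: "\<And>i n. i \<in> S \<Longrightarrow> trans_prob X (Some i) (Some j) n = 0"
    and closed: "\<And>i l n. i \<in> S \<Longrightarrow> l \<notin> S \<Longrightarrow> l \<noteq> j \<Longrightarrow> trans_prob X (Some i) (Some l) n = 0"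
    and "i \<in> S"
  shows "g_at X (Some i) (Some j) n = 0"
  using \<open>i \<in> S\<close>
proof (induction n arbitrary: i rule: less_induct)
  case (less n)
  have "trans_prob X (Some i) (Some l) k * g_at X (Some l) (Some j) (n - k) = 0"
    if "l \<noteq> j" "k \<le> n" for l k
  proof (cases "l \<in> S \<and> k > 0")
    case True
    then show ?thesis using less.IH[of "n - k" l] that by auto
  next
    case False
    then show ?thesis using closed[OF less.prems] that by (auto simp: trans_prob_0[OF X])
  qed
  then have "(\<Sum>l\<in>-{j}. \<Sum>k\<le>n. trans_prob X (Some i) (Some l) k * g_at X (Some l) (Some j) (n - k)) = 0"
    by (intro sum.neutral ballI) (simp del: mult_eq_0_iff)
  then show ?case
    unfolding renewal_equation[OF X, of "Some i" j n] by (simp add: no_exit less.prems)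
qed

text \<open>
  A maximum principle.  The vector \<open>u = \<Phi>\<^sub>j(\<rho>)\<close> is positive and satisfies \<open>u = p\<^sub>j + P u\<close>, hence is a strict
  supersolution wherever \<open>j\<close> can be entered.  If \<open>x = P x\<close> and \<open>x \<noteq> 0\<close>, let \<open>c\<close> be the maximum of \<open>\<bar>x\<^sub>i\<bar> / u\<^sub>i\<close>.
  At a maximizer \<open>i\<close>,
  \<open>c u\<^sub>i = \<bar>x\<^sub>i\<bar> \<le> \<Sum>\<^sub>l p\<^sub>i\<^sub>l \<bar>x\<^sub>l\<bar> \<le> c \<Sum>\<^sub>l p\<^sub>i\<^sub>l u\<^sub>l = c (u\<^sub>i - p\<^sub>i\<^sub>j)\<close>,
  so \<open>p\<^sub>i\<^sub>j = 0\<close> and every \<open>l\<close> with \<open>p\<^sub>i\<^sub>l > 0\<close> is a maximizer as well.  Thus \<open>j\<close> cannot be reached from the set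
  \<open>S\<close> of maximizers, contrary to the hypothesis.
\<close>

lemma invertible_1_minus_P_mat:
  fixes X :: "('w, 'n::finite) renewal_process"
  assumes X: "markov_renewal X"
    and reach: "\<And>i. 0 < g_tot X (Some i) (Some j)"
    and fin_p: "\<And>i l. p_mom X (Some i) (Some l) \<rho> 0 < \<infinity>"
    and fin_phi: "\<And>i. phi X (Some i) (Some j) \<rho> 0 < \<infinity>"
  shows "invertible (mat 1 - P_mat X j \<rho>)"
proof -
  define p where "p i l = enn2real (p_mom X (Some i) (Some l) \<rho> 0)" for i l
  define u where "u i = enn2real (phi X (Some i) (Some j) \<rho> 0)" for i
  have p_nonneg: "0 \<le> p i l" for i l by (simp add: p_def)
  have p_0: "trans_prob X (Some i) (Some l) n = 0" if "p i l = 0" for i l n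
    using that fin_p[of i l] p_mom_eq_0_D[OF X] by (auto simp: p_def enn2real_eq_0_iff)
  have u_pos: "0 < u i" for i
    using phi_pos[OF X reach, of i \<rho>] fin_phi[of i] by (simp add: u_def enn2real_positive_iff)
  have u_eq: "u i = p i j + (\<Sum>l\<in>-{j}. p i l * u l)" for i
    using moment_renewal_equation_real[OF X, of 0 "Some i" \<rho> j] fin_p fin_phi by (simp add: u_def p_def)
  have "x = 0" if "(mat 1 - P_mat X j \<rho>) *v x = 0" for x
  proof (rule ccontr)
    assume "x \<noteq> 0"
    have x_eq: "x $ i = (\<Sum>l\<in>-{j}. p i l * x $ l)" for i
    proof -
      have "x $ i = (P_mat X j \<rho> *v x) $ i"
        using that by (simp add: matrix_vector_mult_diff_rdistrib)
      also have "\<dots> = (\<Sum>l\<in>-{j}. p i l * x $ l)"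
        by (auto simp: P_mat_def matrix_vector_mult_def p_def intro!: sum.mono_neutral_cong_right split: if_splits)
      finally show ?thesis .
    qed
    define c where "c = Max (range (\<lambda>i. \<bar>x $ i\<bar> / u i))"
    have "\<bar>x $ i\<bar> / u i \<le> c" for i by (simp add: c_def)
    then have x_le: "\<bar>x $ i\<bar> \<le> c * u i" for i
      by (rule pos_divide_le_eq[OF u_pos, THEN iffD1])
    have "c \<in> range (\<lambda>i. \<bar>x $ i\<bar> / u i)" unfolding c_def by (intro Max_in) auto
    then obtain i\<^sub>0 where "c = \<bar>x $ i\<^sub>0\<bar> / u i\<^sub>0" by blast
    then have i\<^sub>0: "\<bar>x $ i\<^sub>0\<bar> = c * u i\<^sub>0" using u_pos[of i\<^sub>0] by simp
    obtain i\<^sub>1 where "x $ i\<^sub>1 \<noteq> 0" using \<open>x \<noteq> 0\<close> by (auto simp: vec_eq_iff)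
    then have "0 < c * u i\<^sub>1" using x_le[of i\<^sub>1] by linarith
    then have c: "0 < c" using u_pos[of i\<^sub>1] by (simp add: zero_less_mult_iff)
    define S where "S = {i. \<bar>x $ i\<bar> = c * u i}"
    have S: "p i j = 0 \<and> (\<forall>l\<in>-{j}. p i l * (c * u l - \<bar>x $ l\<bar>) = 0)" if "i \<in> S" for i
    proof -
      have "c * u i = \<bar>x $ i\<bar>" using that by (simp add: S_def)
      also have "\<dots> \<le> (\<Sum>l\<in>-{j}. p i l * \<bar>x $ l\<bar>)"
        using p_nonneg unfolding x_eq[of i] by (intro order_trans[OF sum_abs]) (simp add: abs_mult)
      finally have "c * p i j + (\<Sum>l\<in>-{j}. p i l * (c * u l - \<bar>x $ l\<bar>)) \<le> 0"
        by (subst (asm) u_eq) (simp add: algebra_simps sum_subtractf sum_distrib_left)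
      moreover have nonneg: "0 \<le> p i l * (c * u l - \<bar>x $ l\<bar>)" for l using p_nonneg x_le by simp
      moreover have "0 \<le> c * p i j" using c p_nonneg by simp
      moreover have "0 \<le> (\<Sum>l\<in>-{j}. p i l * (c * u l - \<bar>x $ l\<bar>))" using nonneg by (intro sum_nonneg) simp
      ultimately have "c * p i j = 0" "(\<Sum>l\<in>-{j}. p i l * (c * u l - \<bar>x $ l\<bar>)) = 0" by linarith+
      then show ?thesis using c nonneg by (simp add: sum_nonneg_eq_0_iff)
    qed
    have "g_at X (Some i\<^sub>0) (Some j) n = 0" for n
    proof (rule g_at_eq_0_of_closed[OF X])
      show "i\<^sub>0 \<in> S" using i\<^sub>0 by (simp add: S_def)
      show "trans_prob X (Some i) (Some j) n = 0" if "i \<in> S" for i n using S[OF that] p_0 by blast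
      show "trans_prob X (Some i) (Some l) n = 0" if "i \<in> S" "l \<notin> S" "l \<noteq> j" for i l n
      proof (rule p_0)
        have "c * u l - \<bar>x $ l\<bar> \<noteq> 0" using that by (simp add: S_def)
        moreover have "p i l * (c * u l - \<bar>x $ l\<bar>) = 0" using S[OF that(1)] that(3) by blast
        ultimately show "p i l = 0" by simp
      qed
    qed
    then have "g_at X (Some i\<^sub>0) (Some j) = (\<lambda>_. 0)" by auto
    then have "g_tot X (Some i\<^sub>0) (Some j) = 0"
      using g_at_sums_g_tot[OF X, of "Some i\<^sub>0" j] by (simp add: sums_iff)
    then show False using reach[of i\<^sub>0] by simp
  qed
  then have "\<exists>B. B ** (mat 1 - P_mat X j \<rho>) = mat 1" by (subst matrix_left_invertible_ker) blast
  then show ?thesis unfolding invertible_def using matrix_left_right_inverse by blast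
qed

section \<open>Asymptotic expansions at zero\<close>

text \<open>
  The analytic part of \<^const>\<open>expands\<close> for a function that is already real-valued, so that sums, products
  and differences of expansions make sense.
\<close>

definition real_expands :: "(real \<Rightarrow> real) \<Rightarrow> (nat \<Rightarrow> real) \<Rightarrow> nat \<Rightarrow> bool" where
  "real_expands f c K \<longleftrightarrow> (\<lambda>\<epsilon>. f \<epsilon> - (\<Sum>n\<le>K. c n * \<epsilon> ^ n)) \<in> o[at_right 0](\<lambda>\<epsilon>. \<epsilon> ^ K)"

lemma power_smallo_at_right_0:
  assumes "m < n"
  shows "(\<lambda>\<epsilon>::real. \<epsilon> ^ n) \<in> o[at_right 0](\<lambda>\<epsilon>. \<epsilon> ^ m)"
proof (rule smalloI_tendsto)
  have "((\<lambda>\<epsilon>::real. \<epsilon> ^ (n - m)) \<longlongrightarrow> 0 ^ (n - m)) (at_right 0)"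
    by (intro tendsto_intros)
  moreover have "\<forall>\<^sub>F \<epsilon> in at_right 0. \<epsilon> ^ (n - m) = \<epsilon> ^ n / (\<epsilon>::real) ^ m"
    using assms by (auto simp: eventually_at_filter power_diff)
  ultimately have "((\<lambda>\<epsilon>::real. \<epsilon> ^ n / \<epsilon> ^ m) \<longlongrightarrow> 0 ^ (n - m)) (at_right 0)"
    using tendsto_cong by fast
  then show "((\<lambda>\<epsilon>::real. \<epsilon> ^ n / \<epsilon> ^ m) \<longlongrightarrow> 0) (at_right 0)"
    using assms by (simp add: power_0_left)
  show "\<forall>\<^sub>F \<epsilon> in at_right 0. (\<epsilon>::real) ^ m \<noteq> 0"
    using eventually_at_right_less[of "0::real"] by eventually_elim simp
qed

lemma real_expands_coeff_cong:
  assumes "real_expands f c K" "\<And>n. n \<le> K \<Longrightarrow> c n = d n"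
  shows "real_expands f d K"
proof -
  have "(\<Sum>n\<le>K. c n * \<epsilon> ^ n) = (\<Sum>n\<le>K. d n * \<epsilon> ^ n)" for \<epsilon> using assms(2) by simp
  then show ?thesis using assms(1) by (simp add: real_expands_def)
qed

lemma real_expands_mono:
  assumes "real_expands f c K" "m \<le> K"
  shows "real_expands f c m"
proof -
  have "(\<lambda>\<epsilon>. \<epsilon> ^ K) \<in> O[at_right 0](\<lambda>\<epsilon>::real. \<epsilon> ^ m)"
    using assms(2) power_smallo_at_right_0[of m K] by (cases "m = K") (auto intro: landau_o.small_imp_big)
  then have "(\<lambda>\<epsilon>. f \<epsilon> - (\<Sum>n\<le>K. c n * \<epsilon> ^ n)) \<in> o[at_right 0](\<lambda>\<epsilon>. \<epsilon> ^ m)"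
    using assms(1) unfolding real_expands_def by (rule landau_o.small_big_trans[rotated])
  moreover have "(\<lambda>\<epsilon>. \<Sum>n\<in>{m<..K}. c n * \<epsilon> ^ n) \<in> o[at_right 0](\<lambda>\<epsilon>. \<epsilon> ^ m)"
    by (intro big_sum_in_smallo) (simp add: power_smallo_at_right_0)
  ultimately have "(\<lambda>\<epsilon>. (f \<epsilon> - (\<Sum>n\<le>K. c n * \<epsilon> ^ n)) + (\<Sum>n\<in>{m<..K}. c n * \<epsilon> ^ n)) \<in> o[at_right 0](\<lambda>\<epsilon>. \<epsilon> ^ m)"
    by (rule sum_in_smallo)
  moreover have "{..K} = {..m} \<union> {m<..K}" using assms(2) by auto
  ultimately show ?thesis
    unfolding real_expands_def by (simp add: sum.union_disjoint ivl_disj_int algebra_simps)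
qed

lemma real_expands_tendsto:
  assumes "real_expands f c K"
  shows "(f \<longlongrightarrow> c 0) (at_right 0)"
proof -
  have "(\<lambda>\<epsilon>. f \<epsilon> - c 0) \<in> o[at_right 0](\<lambda>_. 1)"
    using real_expands_mono[OF assms, of 0] by (simp add: real_expands_def)
  then have "((\<lambda>\<epsilon>. f \<epsilon> - c 0) \<longlongrightarrow> 0) (at_right 0)" using smalloD_tendsto by fastforce
  then show ?thesis by (simp add: LIM_zero_iff)
qed

lemma real_expands_polynomial: "real_expands (\<lambda>\<epsilon>. \<Sum>n\<le>K. c n * \<epsilon> ^ n) c K"
  by (simp add: real_expands_def)

lemma real_expands_add:
  assumes "real_expands f c K" "real_expands g d K"
  shows "real_expands (\<lambda>\<epsilon>. f \<epsilon> + g \<epsilon>) (\<lambda>n. c n + d n) K"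
  using sum_in_smallo(1)[OF assms[unfolded real_expands_def]]
  by (simp add: real_expands_def algebra_simps sum.distrib)

lemma real_expands_cmult:
  assumes "real_expands f c K"
  shows "real_expands (\<lambda>\<epsilon>. a * f \<epsilon>) (\<lambda>n. a * c n) K"
proof (cases "a = 0")
  case False
  then have "(\<lambda>\<epsilon>. a * (f \<epsilon> - (\<Sum>n\<le>K. c n * \<epsilon> ^ n))) \<in> o[at_right 0](\<lambda>\<epsilon>. \<epsilon> ^ K)"
    using assms by (simp add: real_expands_def)
  then show ?thesis by (simp add: real_expands_def algebra_simps sum_distrib_left)
qed (simp add: real_expands_def)

lemma real_expands_sum:
  assumes "\<And>x. x \<in> A \<Longrightarrow> real_expands (f x) (c x) K"
  shows "real_expands (\<lambda>\<epsilon>. \<Sum>x\<in>A. f x \<epsilon>) (\<lambda>n. \<Sum>x\<in>A. c x n) K"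
proof (cases "finite A")
  case True
  from this assms show ?thesis
  proof (induction A)
    case empty
    show ?case by (simp add: real_expands_def)
  next
    case (insert a A)
    then show ?case by (simp add: real_expands_add)
  qed
qed (simp add: real_expands_def)

text \<open>
  The product of the two truncating polynomials agrees with the Cauchy product up to order \<open>K\<close>; the
  surplus consists of monomials of degree above \<open>K\<close>.  The error terms are multiplied by functions that
  are bounded because they converge at \<open>0\<close>.
\<close>

lemma real_expands_mult:
  assumes f: "real_expands f c K" and g: "real_expands g d K"
  shows "real_expands (\<lambda>\<epsilon>. f \<epsilon> * g \<epsilon>) (\<lambda>n. \<Sum>q\<le>n. c q * d (n - q)) K"
proof -
  let ?F = "\<lambda>\<epsilon>. \<Sum>n\<le>K. c n * \<epsilon> ^ n" and ?G = "\<lambda>\<epsilon>. \<Sum>n\<le>K. d n * \<epsilon> ^ n"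
  let ?hi = "{(q, s). q \<le> K \<and> s \<le> K \<and> K < q + s}"
  let ?H = "\<lambda>\<epsilon>. \<Sum>(q, s)\<in>?hi. c q * d s * \<epsilon> ^ (q + s)"
  have bounded: "h \<in> O[at_right 0](\<lambda>_. 1)" if "(h \<longlongrightarrow> l) (at_right 0)" for h and l :: real
    using that by (intro bigoI_tendsto[where c = l]) auto
  have fin: "finite ?hi" by (rule finite_subset[of _ "{..K} \<times> {..K}"]) auto
  have split: "?F \<epsilon> * ?G \<epsilon> = (\<Sum>n\<le>K. (\<Sum>q\<le>n. c q * d (n - q)) * \<epsilon> ^ n) + ?H \<epsilon>" for \<epsilon>
  proof -
    have "?F \<epsilon> * ?G \<epsilon> = (\<Sum>(q, s)\<in>{..K} \<times> {..K}. c q * d s * \<epsilon> ^ (q + s))"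
      by (simp add: sum_product sum.cartesian_product power_add mult_ac)
    also have "{..K} \<times> {..K} = {(q, s). q + s \<le> K} \<union> ?hi" by auto
    also have "(\<Sum>(q, s)\<in>{(q, s). q + s \<le> K} \<union> ?hi. c q * d s * \<epsilon> ^ (q + s)) =
        (\<Sum>(q, s)\<in>{(q, s). q + s \<le> K}. c q * d s * \<epsilon> ^ (q + s)) + ?H \<epsilon>"
      using fin by (intro sum.union_disjoint) (auto intro: finite_subset[of _ "{..K} \<times> {..K}"])
    also have "(\<Sum>(q, s)\<in>{(q, s). q + s \<le> K}. c q * d s * \<epsilon> ^ (q + s)) =
        (\<Sum>n\<le>K. (\<Sum>q\<le>n. c q * d (n - q)) * \<epsilon> ^ n)"
      by (simp add: sum.triangle_reindex_eq sum_distrib_right)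
    finally show ?thesis .
  qed
  have "(\<lambda>\<epsilon>. c q * d s * \<epsilon> ^ (q + s)) \<in> o[at_right 0](\<lambda>\<epsilon>. \<epsilon> ^ K)" if "K < q + s" for q s
    using power_smallo_at_right_0[OF that] by (cases "c q * d s = 0") auto
  then have "?H \<in> o[at_right 0](\<lambda>\<epsilon>. \<epsilon> ^ K)"
    by (intro big_sum_in_smallo) auto
  moreover have "(\<lambda>\<epsilon>. ?F \<epsilon> * (g \<epsilon> - ?G \<epsilon>)) \<in> o[at_right 0](\<lambda>\<epsilon>. 1 * \<epsilon> ^ K)"
    using g real_expands_tendsto[OF real_expands_polynomial[of c K]]
    by (intro landau_o.big_small_mult bounded) (auto simp: real_expands_def)
  moreover have "(\<lambda>\<epsilon>. g \<epsilon> * (f \<epsilon> - ?F \<epsilon>)) \<in> o[at_right 0](\<lambda>\<epsilon>. 1 * \<epsilon> ^ K)"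
    using f real_expands_tendsto[OF g]
    by (intro landau_o.big_small_mult bounded) (auto simp: real_expands_def)
  ultimately have "(\<lambda>\<epsilon>. ?H \<epsilon> + (?F \<epsilon> * (g \<epsilon> - ?G \<epsilon>) + g \<epsilon> * (f \<epsilon> - ?F \<epsilon>))) \<in> o[at_right 0](\<lambda>\<epsilon>. \<epsilon> ^ K)"
    by (intro sum_in_smallo) simp_all
  moreover have "f \<epsilon> * g \<epsilon> - (\<Sum>n\<le>K. (\<Sum>q\<le>n. c q * d (n - q)) * \<epsilon> ^ n) =
      ?H \<epsilon> + (?F \<epsilon> * (g \<epsilon> - ?G \<epsilon>) + g \<epsilon> * (f \<epsilon> - ?F \<epsilon>))" for \<epsilon>
    using split[of \<epsilon>] by (simp add: algebra_simps)
  ultimately show ?thesis unfolding real_expands_def by simp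
qed

text \<open>
  A residual estimate turns the formal solution into an asymptotic one.  Let
  \<open>F\<close> be the polynomial formed from the formal solution \<open>c\<close>, and \<open>D = x - F\<close>.  By the choice of \<open>c\<close>, \<open>F\<close>
  solves the system up to a residual \<open>E = o(\<epsilon>\<^sup>K)\<close>, whence \<open>(I - A\<^sub>0) D = E + (P - A\<^sub>0) D\<close>.  As
  \<open>P \<rightarrow> A\<^sub>0\<close>, the last term can be absorbed on the left, which leaves \<open>D = o(\<epsilon>\<^sup>K)\<close>.
\<close>

lemma real_expands_solution:
  fixes P :: "real \<Rightarrow> real ^ 'n ^ 'n" and x y :: "real \<Rightarrow> real ^ 'n"
    and A :: "nat \<Rightarrow> real ^ 'n ^ 'n" and b c :: "nat \<Rightarrow> real ^ 'n"
  assumes eq: "\<forall>\<^sub>F \<epsilon> in at_right 0. x \<epsilon> = y \<epsilon> + P \<epsilon> *v x \<epsilon>"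
    and P: "\<And>i l. real_expands (\<lambda>\<epsilon>. P \<epsilon> $ i $ l) (\<lambda>n. A n $ i $ l) K"
    and y: "\<And>i. real_expands (\<lambda>\<epsilon>. y \<epsilon> $ i) (\<lambda>n. b n $ i) K"
    and inv: "invertible (mat 1 - A 0)"
    and c: "\<And>n. n \<le> K \<Longrightarrow> c n = b n + (\<Sum>q\<le>n. A q *v c (n - q))"
  shows "real_expands (\<lambda>\<epsilon>. x \<epsilon> $ i) (\<lambda>n. c n $ i) K"
proof -
  define F where "F \<epsilon> = (\<chi> i. \<Sum>n\<le>K. c n $ i * \<epsilon> ^ n)" for \<epsilon>
  define D where "D \<epsilon> = x \<epsilon> - F \<epsilon>" for \<epsilon>
  define E where "E \<epsilon> = y \<epsilon> + P \<epsilon> *v F \<epsilon> - F \<epsilon>" for \<epsilon>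
  obtain U where U: "U ** (mat 1 - A 0) = mat 1" using inv unfolding invertible_def by blast
  have F: "real_expands (\<lambda>\<epsilon>. F \<epsilon> $ i) (\<lambda>n. c n $ i) K" for i
    by (simp add: F_def real_expands_polynomial)
  have "real_expands (\<lambda>\<epsilon>. (y \<epsilon> + P \<epsilon> *v F \<epsilon>) $ i)
      (\<lambda>n. b n $ i + (\<Sum>l\<in>UNIV. \<Sum>q\<le>n. A q $ i $ l * c (n - q) $ l)) K" for i
    unfolding vector_add_component matrix_vector_mult_def vec_lambda_beta
    by (intro real_expands_add y real_expands_sum real_expands_mult P F)
  moreover have "b n $ i + (\<Sum>l\<in>UNIV. \<Sum>q\<le>n. A q $ i $ l * c (n - q) $ l) = c n $ i" if "n \<le> K" for n i
    unfolding c[OF that]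
    by (simp add: sum_component matrix_vector_mult_def) (rule sum.swap)
  ultimately have "real_expands (\<lambda>\<epsilon>. (y \<epsilon> + P \<epsilon> *v F \<epsilon>) $ i) (\<lambda>n. c n $ i) K" for i
    by (rule real_expands_coeff_cong)
  then have E: "(\<lambda>\<epsilon>. E \<epsilon> $ i) \<in> o[at_right 0](\<lambda>\<epsilon>. \<epsilon> ^ K)" for i
    by (simp add: E_def real_expands_def F_def)
  \<comment> \<open>In the sum norm \<open>S\<close> of \<open>D\<close> the equation becomes \<open>S \<le> e + w S\<close>, with \<open>e = o(\<epsilon>\<^sup>K)\<close> and \<open>w \<rightarrow> 0\<close>.\<close>
  define e where "e \<epsilon> = (\<Sum>i\<in>UNIV. \<Sum>a\<in>UNIV. \<bar>U $ i $ a\<bar> * \<bar>E \<epsilon> $ a\<bar>)" for \<epsilon>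
  define w where "w \<epsilon> = (\<Sum>i\<in>UNIV. \<Sum>a\<in>UNIV. \<bar>U $ i $ a\<bar> * (\<Sum>l\<in>UNIV. \<bar>P \<epsilon> $ a $ l - A 0 $ a $ l\<bar>))" for \<epsilon>
  define S where "S \<epsilon> = (\<Sum>i\<in>UNIV. \<bar>D \<epsilon> $ i\<bar>)" for \<epsilon>
  have D_le_S: "\<bar>D \<epsilon> $ i\<bar> \<le> S \<epsilon>" for i \<epsilon> unfolding S_def by (rule member_le_sum) auto
  have e: "e \<in> o[at_right 0](\<lambda>\<epsilon>. \<epsilon> ^ K)"
    unfolding e_def
  proof (intro big_sum_in_smallo)
    show "(\<lambda>\<epsilon>. \<bar>U $ i $ a\<bar> * \<bar>E \<epsilon> $ a\<bar>) \<in> o[at_right 0](\<lambda>\<epsilon>. \<epsilon> ^ K)" for i a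
      using E[of a] by (cases "U $ i $ a = 0") auto
  qed
  have "((\<lambda>\<epsilon>. \<bar>P \<epsilon> $ a $ l - A 0 $ a $ l\<bar>) \<longlongrightarrow> \<bar>A 0 $ a $ l - A 0 $ a $ l\<bar>) (at_right 0)" for a l
    by (intro tendsto_intros real_expands_tendsto[OF P])
  then have "(w \<longlongrightarrow> (\<Sum>i\<in>UNIV. \<Sum>a\<in>UNIV. \<bar>U $ i $ a\<bar> * (\<Sum>l\<in>UNIV. \<bar>A 0 $ a $ l - A 0 $ a $ l\<bar>))) (at_right 0)"
    unfolding w_def by (intro tendsto_sum tendsto_mult tendsto_const)
  then have "\<forall>\<^sub>F \<epsilon> in at_right 0. w \<epsilon> < 1/2"
    by (rule order_tendstoD(2)) simp
  then have "\<forall>\<^sub>F \<epsilon> in at_right 0. norm (D \<epsilon> $ i) \<le> 2 * norm (e \<epsilon>)"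
    using eq
  proof eventually_elim
    case (elim \<epsilon>)
    have "D \<epsilon> = E \<epsilon> + P \<epsilon> *v D \<epsilon>"
      unfolding D_def E_def matrix_vector_mult_diff_distrib by (subst elim(2)) (simp add: algebra_simps)
    then have "(mat 1 - A 0) *v D \<epsilon> = E \<epsilon> + (P \<epsilon> - A 0) *v D \<epsilon>"
      by (simp add: matrix_vector_mult_diff_rdistrib algebra_simps)
    then have fixpoint: "D \<epsilon> = U *v (E \<epsilon> + (P \<epsilon> - A 0) *v D \<epsilon>)"
      by (metis U matrix_vector_mul_assoc matrix_vector_mul_lid)
    have D_eq: "D \<epsilon> $ i = (\<Sum>a\<in>UNIV. U $ i $ a * (E \<epsilon> $ a + (\<Sum>l\<in>UNIV. (P \<epsilon> $ a $ l - A 0 $ a $ l) * D \<epsilon> $ l)))" for i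
      by (rule trans[OF arg_cong[OF fixpoint, where f = "\<lambda>v. v $ i"]]) (simp add: matrix_vector_mult_def)
    have "\<bar>D \<epsilon> $ i\<bar> \<le> (\<Sum>a\<in>UNIV. \<bar>U $ i $ a\<bar> * (\<bar>E \<epsilon> $ a\<bar> + (\<Sum>l\<in>UNIV. \<bar>P \<epsilon> $ a $ l - A 0 $ a $ l\<bar> * S \<epsilon>)))" for i
      unfolding D_eq[of i]
    proof (intro order_trans[OF sum_abs] sum_mono)
      fix a
      have "\<bar>\<Sum>l\<in>UNIV. (P \<epsilon> $ a $ l - A 0 $ a $ l) * D \<epsilon> $ l\<bar> \<le> (\<Sum>l\<in>UNIV. \<bar>P \<epsilon> $ a $ l - A 0 $ a $ l\<bar> * S \<epsilon>)"
        unfolding abs_mult using D_le_S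
        by (intro order_trans[OF sum_abs] sum_mono) (simp add: abs_mult mult_left_mono)
      then have "\<bar>E \<epsilon> $ a + (\<Sum>l\<in>UNIV. (P \<epsilon> $ a $ l - A 0 $ a $ l) * D \<epsilon> $ l)\<bar> \<le>
          \<bar>E \<epsilon> $ a\<bar> + (\<Sum>l\<in>UNIV. \<bar>P \<epsilon> $ a $ l - A 0 $ a $ l\<bar> * S \<epsilon>)"
        by linarith
      then show "\<bar>U $ i $ a * (E \<epsilon> $ a + (\<Sum>l\<in>UNIV. (P \<epsilon> $ a $ l - A 0 $ a $ l) * D \<epsilon> $ l))\<bar> \<le>
          \<bar>U $ i $ a\<bar> * (\<bar>E \<epsilon> $ a\<bar> + (\<Sum>l\<in>UNIV. \<bar>P \<epsilon> $ a $ l - A 0 $ a $ l\<bar> * S \<epsilon>))"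
        unfolding abs_mult by (intro mult_left_mono) auto
    qed
    then have "S \<epsilon> \<le> (\<Sum>i\<in>UNIV. \<Sum>a\<in>UNIV. \<bar>U $ i $ a\<bar> * (\<bar>E \<epsilon> $ a\<bar> + (\<Sum>l\<in>UNIV. \<bar>P \<epsilon> $ a $ l - A 0 $ a $ l\<bar> * S \<epsilon>)))"
      unfolding S_def by (intro sum_mono)
    also have "\<dots> = e \<epsilon> + w \<epsilon> * S \<epsilon>"
      by (simp add: e_def w_def distrib_left sum.distrib sum_distrib_right mult.assoc)
    also have "w \<epsilon> * S \<epsilon> \<le> 1/2 * S \<epsilon>"
      using elim(1) by (intro mult_right_mono) (auto simp: S_def intro: sum_nonneg)
    finally have "S \<epsilon> \<le> 2 * e \<epsilon>" by simp
    then show ?case using D_le_S[of \<epsilon> i] by simp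
  qed
  then have "(\<lambda>\<epsilon>. D \<epsilon> $ i) \<in> O[at_right 0](e)" by (rule bigoI)
  then have "(\<lambda>\<epsilon>. D \<epsilon> $ i) \<in> o[at_right 0](\<lambda>\<epsilon>. \<epsilon> ^ K)" using e by (rule landau_o.big_small_trans)
  then show ?thesis by (simp add: D_def F_def real_expands_def)
qed

section \<open>Coefficients of the formal solution\<close>

lemma eventually_near_zero_iff:
  "eventually Q near_zero \<longleftrightarrow> Q 0 \<and> eventually Q (at_right (0::real))"
proof -
  have "eventually Q near_zero \<longleftrightarrow> (\<forall>\<^sub>F x in nhds 0. x \<in> {0..} \<longrightarrow> Q x)"
    by (simp add: eventually_inf_principal)
  also have "\<dots> \<longleftrightarrow> Q 0 \<and> (\<forall>\<^sub>F x in at 0. x \<in> {0..} \<longrightarrow> Q x)"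
    by (auto simp: eventually_nhds_conv_at)
  also have "(\<forall>\<^sub>F x in at 0. x \<in> {0..} \<longrightarrow> Q x) \<longleftrightarrow> eventually Q (at_right 0)"
    unfolding eventually_at_filter by (intro eventually_cong refl always_eventually allI) auto
  finally show ?thesis .
qed

lemma expands_iff:
  "expands F c m \<longleftrightarrow> F 0 < \<infinity> \<and> (\<forall>\<^sub>F \<epsilon> in at_right 0. F \<epsilon> < \<infinity>) \<and> c 0 = enn2real (F 0) \<and>
     real_expands (\<lambda>\<epsilon>. enn2real (F \<epsilon>)) c m"
  unfolding expands_def real_expands_def eventually_near_zero_iff by blast

lemma sum_matrix_vector_mult:
  fixes A :: "'b \<Rightarrow> real ^ 'n ^ 'm"
  shows "(\<Sum>a\<in>S. A a) *v x = (\<Sum>a\<in>S. A a *v x)"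
  by (induction S rule: infinite_finite_induct) (simp_all add: matrix_vector_mult_add_rdistrib)

lemma matrix_vector_mult_sum:
  fixes A :: "real ^ 'n ^ 'm"
  shows "A *v (\<Sum>a\<in>S. x a) = (\<Sum>a\<in>S. A *v x a)"
  by (rule linear_sum[OF matrix_vector_mul_linear])

text \<open>
  In terms of formal power series in \<open>\<epsilon>\<close>: if \<open>U = I + A U\<close>, then \<open>c = U b\<close> solves \<open>c = b + A c\<close>.
\<close>

lemma resolvent_series_recursion:
  fixes A U :: "nat \<Rightarrow> real ^ 'n ^ 'n" and b :: "nat \<Rightarrow> real ^ 'n"
  assumes U: "\<And>n. U n = (if n = 0 then mat 1 else 0) + (\<Sum>q\<le>n. A q ** U (n - q))"
  shows "(\<Sum>q\<le>n. U q *v b (n - q)) = b n + (\<Sum>q\<le>n. A q *v (\<Sum>s\<le>n - q. U s *v b (n - q - s)))"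
proof -
  have "(\<Sum>q\<le>n. A q *v (\<Sum>s\<le>n - q. U s *v b (n - q - s))) =
      (\<Sum>q\<le>n. \<Sum>s\<le>n - q. (A q ** U s) *v b (n - (q + s)))"
    by (simp add: matrix_vector_mult_sum matrix_vector_mul_assoc)
  also have "\<dots> = (\<Sum>(q, s)\<in>{(q, s). q + s \<le> n}. (A q ** U s) *v b (n - (q + s)))"
    by (subst sum.Sigma) (auto intro!: sum.cong)
  also have "\<dots> = (\<Sum>t\<le>n. \<Sum>q\<le>t. (A q ** U (t - q)) *v b (n - t))"
    by (simp add: sum.triangle_reindex_eq)
  also have "\<dots> = (\<Sum>t\<le>n. (\<Sum>q\<le>t. A q ** U (t - q)) *v b (n - t))"
    by (simp add: sum_matrix_vector_mult)
  finally have conv: "(\<Sum>q\<le>n. A q *v (\<Sum>s\<le>n - q. U s *v b (n - q - s))) =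
      (\<Sum>t\<le>n. (\<Sum>q\<le>t. A q ** U (t - q)) *v b (n - t))" .
  have "(\<Sum>q\<le>n. U q *v b (n - q)) =
      (\<Sum>t\<le>n. (if t = 0 then b n else 0) + (\<Sum>q\<le>t. A q ** U (t - q)) *v b (n - t))"
    by (subst U) (auto simp: matrix_vector_mult_add_rdistrib intro!: sum.cong)
  also have "\<dots> = b n + (\<Sum>t\<le>n. (\<Sum>q\<le>t. A q ** U (t - q)) *v b (n - t))"
    by (simp add: sum.distrib)
  finally show ?thesis unfolding conv .
qed

lemma invertible_matrix_inv:
  fixes A :: "real ^ 'n ^ 'n"
  assumes "invertible A"
  shows "A ** matrix_inv A = mat 1" and "matrix_inv A ** A = mat 1"
proof -
  have "A ** matrix_inv A = mat 1 \<and> matrix_inv A ** A = mat 1"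
    using assms unfolding invertible_def matrix_inv_def by (rule someI_ex)
  then show "A ** matrix_inv A = mat 1" and "matrix_inv A ** A = mat 1" by blast+
qed

text \<open>
  The matrices \<open>U[n]\<close> are the coefficients of the formal inverse of \<open>I - P(\<epsilon>)\<close>: moving the term
  \<open>P[0] U[n]\<close> to the right turns their definition into \<open>U = I + P U\<close>.
\<close>

lemma U_coef_recursion:
  fixes X\<^sub>0 :: "('w, 'n::finite) renewal_process"
  assumes inv: "invertible (mat 1 - P_mat X\<^sub>0 j \<rho>)" and P0: "P_coef pc j 0 0 = P_mat X\<^sub>0 j \<rho>"
  shows "U_coef X\<^sub>0 \<rho> pc j n =
    (if n = 0 then mat 1 else 0) + (\<Sum>q\<le>n. P_coef pc j 0 q ** U_coef X\<^sub>0 \<rho> pc j (n - q))"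
proof -
  let ?M = "mat 1 - P_mat X\<^sub>0 j \<rho>" and ?U = "U_coef X\<^sub>0 \<rho> pc j"
  note M = invertible_matrix_inv(1)[OF inv]
  have "?M ** ?U n = (if n = 0 then mat 1 else (\<Sum>q=1..n. P_coef pc j 0 q ** ?U (n - q)))"
  proof (cases n)
    case 0
    then show ?thesis by (simp add: M)
  next
    case (Suc n')
    then show ?thesis by (simp only: U_coef.simps matrix_mul_assoc M matrix_mul_lid) simp
  qed
  moreover have "?M ** ?U n = ?U n - P_mat X\<^sub>0 j \<rho> ** ?U n"
    by (simp add: matrix_eq matrix_vector_mul_assoc[symmetric] matrix_vector_mult_diff_rdistrib)
  ultimately have "?U n = P_mat X\<^sub>0 j \<rho> ** ?U n +
      (if n = 0 then mat 1 else (\<Sum>q=1..n. P_coef pc j 0 q ** ?U (n - q)))"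
    by (simp add: algebra_simps)
  also have "\<dots> = (if n = 0 then mat 1 else 0) + (\<Sum>q\<le>n. P_coef pc j 0 q ** ?U (n - q))"
  proof -
    have "{..n} = insert 0 {1..n}" by auto
    then show ?thesis by (simp add: P0)
  qed
  finally show ?thesis .
qed

section \<open>Expansion of the moment vectors\<close>

theorem theorem1:
  fixes X :: "real \<Rightarrow> ('w, 'n::finite) renewal_process"
    and \<beta> \<delta> \<rho> :: real
    and k :: nat
    and pc :: "'n \<Rightarrow> 'n state \<Rightarrow> nat \<Rightarrow> nat \<Rightarrow> real"
    and j :: 'n
  assumes "\<And>\<epsilon>. \<epsilon> \<ge> 0 \<Longrightarrow> markov_renewal (X \<epsilon>)"
    and "cond_A X"
    and "cond_B X"
    and "cond_C X \<beta>"
    and "admissible_delta X \<beta> \<delta>"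
    and "\<rho> < \<delta>"
    and "cond_P X k \<rho> pc"
  shows "vec_expands (\<lambda>\<epsilon>. Phi_vec (X \<epsilon>) j \<rho> 0) (Phi_coef (X 0) \<rho> pc j 0) k \<and>
         (\<forall>r\<in>{1..k}.
           vec_expands (\<lambda>\<epsilon>. Phi_vec (X \<epsilon>) j \<rho> r) (Phi_coef (X 0) \<rho> pc j r) (k - r))"
proof -
  note X = assms(1)
  define p where "p \<epsilon> i l r = enn2real (p_mom (X \<epsilon>) (Some i) (Some l) \<rho> r)" for \<epsilon> i l r
  define f where "f \<epsilon> i r = enn2real (phi (X \<epsilon>) (Some i) (Some j) \<rho> r)" for \<epsilon> i r
  let ?Phi = "Phi_coef (X 0) \<rho> pc j" and ?lam = "lambda_coef (X 0) \<rho> pc j" and ?U = "U_coef (X 0) \<rho> pc j"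
  have P: "expands (\<lambda>\<epsilon>. p_mom (X \<epsilon>) (Some i) (Some l) \<rho> r) (pc i (Some l) r) (k - r)" if "r \<le> k" for i l r
    using assms(7) that unfolding cond_P_def by blast
  have fin_p_0: "p_mom (X 0) (Some i) (Some l) \<rho> r < \<infinity>" if "r \<le> k" for i l r
    using P[OF that] unfolding expands_iff by blast
  have fin_p: "\<forall>\<^sub>F \<epsilon> in at_right 0. \<forall>i l. p_mom (X \<epsilon>) (Some i) (Some l) \<rho> r < \<infinity>" if "r \<le> k" for r
    using P[OF that] unfolding expands_iff by (simp add: eventually_all_finite)
  have pc_0: "pc i (Some l) r 0 = p 0 i l r" if "r \<le> k" for i l r
    using P[OF that] unfolding expands_iff p_def by blast
  have p_expands: "real_expands (\<lambda>\<epsilon>. p \<epsilon> i l r) (pc i (Some l) r) (k - r)" if "r \<le> k" for i l r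
    using P[OF that] unfolding expands_iff p_def by blast
  \<comment> \<open>Convergence at \<open>\<delta>\<close> makes \<open>\<phi>(\<delta>)\<close> finite for small \<open>\<epsilon>\<close>; since \<open>\<rho> < \<delta>\<close>, so are all \<open>\<phi>(\<rho>, r)\<close>.\<close>
  have delta: "phi (X 0) (Some i) (Some j) \<delta> 0 < \<infinity>"
      "((\<lambda>\<epsilon>. phi (X \<epsilon>) (Some i) (Some j) \<delta> 0) \<longlongrightarrow> phi (X 0) (Some i) (Some j) \<delta> 0) (at_right 0)" for i
    using assms(5) unfolding admissible_delta_def by blast+
  have fin_phi_0: "phi (X 0) (Some i) (Some j) \<rho> r < \<infinity>" for i r
    by (rule phi_finite_moment[OF delta(1) assms(6)])
  have fin_phi: "\<forall>\<^sub>F \<epsilon> in at_right 0. \<forall>i r. phi (X \<epsilon>) (Some i) (Some j) \<rho> r < \<infinity>"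
  proof -
    have "\<forall>\<^sub>F \<epsilon> in at_right 0. phi (X \<epsilon>) (Some i) (Some j) \<delta> 0 < \<infinity>" for i
      using order_tendstoD(2)[OF delta(2)] delta(1) by blast
    then have "\<forall>\<^sub>F \<epsilon> in at_right 0. \<forall>i. phi (X \<epsilon>) (Some i) (Some j) \<delta> 0 < \<infinity>"
      by (simp add: eventually_all_finite)
    then show ?thesis
      by eventually_elim (blast intro: phi_finite_moment[OF _ assms(6)])
  qed
  \<comment> \<open>The summand \<open>m = 0\<close> holds the unknown \<open>\<phi>(\<rho>, r)\<close> itself; the others involve lower \<open>r\<close> only.\<close>
  have renewal: "f \<epsilon> i r = p \<epsilon> i j r + (\<Sum>m=1..r. real (r choose m) * (\<Sum>l\<in>-{j}. p \<epsilon> i l m * f \<epsilon> l (r - m)))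
      + (\<Sum>l\<in>-{j}. p \<epsilon> i l 0 * f \<epsilon> l r)"
    if "\<epsilon> \<ge> 0" and fp: "\<And>l m. m \<le> r \<Longrightarrow> p_mom (X \<epsilon>) (Some i) (Some l) \<rho> m < \<infinity>"
      and fphi: "\<And>l m. phi (X \<epsilon>) (Some l) (Some j) \<rho> m < \<infinity>" for \<epsilon> i r
  proof -
    have "f \<epsilon> i r = p \<epsilon> i j r + (\<Sum>l\<in>-{j}. \<Sum>m\<le>r. real (r choose m) * p \<epsilon> i l m * f \<epsilon> l (r - m))"
      using moment_renewal_equation_real[OF X[OF that(1)], of r "Some i" \<rho> j, OF fp fphi]
      unfolding f_def p_def by simp
    also have "(\<Sum>l\<in>-{j}. \<Sum>m\<le>r. real (r choose m) * p \<epsilon> i l m * f \<epsilon> l (r - m)) =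
        (\<Sum>m\<le>r. real (r choose m) * (\<Sum>l\<in>-{j}. p \<epsilon> i l m * f \<epsilon> l (r - m)))"
      by (subst sum.swap) (simp add: sum_distrib_left mult.assoc)
    also have "{..r} = insert 0 {1..r}" by auto
    finally show ?thesis by simp
  qed
  define y where "y r \<epsilon> = (\<chi> i. p \<epsilon> i j r + (\<Sum>m=1..r. real (r choose m) * (\<Sum>l\<in>-{j}. p \<epsilon> i l m * f \<epsilon> l (r - m))))" for r \<epsilon>
  have mult_offdiag: "(\<Sum>l\<in>UNIV. (if l = j then 0 else a l) * b l) = (\<Sum>l\<in>-{j}. a l * b l)" for a b :: "'n \<Rightarrow> real"
    by (intro sum.mono_neutral_cong_right) auto
  have system: "(\<chi> i. f \<epsilon> i r) = y r \<epsilon> + P_mat (X \<epsilon>) j \<rho> *v (\<chi> i. f \<epsilon> i r)"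
    if "\<epsilon> \<ge> 0" "\<And>i l m. m \<le> r \<Longrightarrow> p_mom (X \<epsilon>) (Some i) (Some l) \<rho> m < \<infinity>"
      "\<And>l m. phi (X \<epsilon>) (Some l) (Some j) \<rho> m < \<infinity>" for \<epsilon> r
  proof -
    have "(y r \<epsilon> + P_mat (X \<epsilon>) j \<rho> *v (\<chi> i. f \<epsilon> i r)) $ i = f \<epsilon> i r" for i
      by (subst renewal[OF that])
        (simp_all add: y_def matrix_vector_mult_def P_mat_def mult_offdiag flip: p_def)
    then show ?thesis by (simp add: vec_eq_iff)
  qed
  have inv: "invertible (mat 1 - P_mat (X 0) j \<rho>)"
    using assms(3) fin_p_0[of 0] fin_phi_0 X unfolding cond_B_def
    by (intro invertible_1_minus_P_mat) auto
  have P_coef_0: "P_coef pc j 0 0 = P_mat (X 0) j \<rho>"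
    by (simp add: P_coef_def P_mat_def pc_0 p_def vec_eq_iff)
  have Phi_0: "?Phi r 0 = (\<chi> i. f 0 i r)" for r
    by (subst Phi_coef.simps) (simp add: f_def Phi_vec_def)
  have lam_0: "?lam r 0 = y r 0" if "r \<le> k" for r
    using that by (subst lambda_coef.simps)
      (simp add: vec_eq_iff y_def p_coef_def P_coef_def Phi_0 matrix_vector_mult_def mult_offdiag pc_0)
  \<comment> \<open>The zeroth coefficient is defined as the unperturbed functional; the unperturbed linear system
    brings it into the same form as the others.\<close>
  have Phi_eq: "?Phi r n = (\<Sum>q\<le>n. ?U q *v ?lam r (n - q))" if r: "r \<le> k" for r n
  proof (cases "n = 0")
    case True
    have "?Phi r 0 = ?lam r 0 + P_mat (X 0) j \<rho> *v ?Phi r 0"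
      unfolding Phi_0 lam_0[OF r] using fin_p_0 fin_phi_0 r by (intro system) auto
    then have "(mat 1 - P_mat (X 0) j \<rho>) *v ?Phi r 0 = ?lam r 0"
      by (simp add: matrix_vector_mult_diff_rdistrib algebra_simps)
    then have "?Phi r 0 = ?U 0 *v ?lam r 0"
      using invertible_matrix_inv(2)[OF inv]
      by (metis U_coef.simps(1) matrix_vector_mul_assoc matrix_vector_mul_lid)
    then show ?thesis using True by simp
  next
    case False
    have "?lam 0 t = p_coef pc j 0 t" for t by (subst lambda_coef.simps) simp
    then show ?thesis using False by (subst Phi_coef.simps) simp
  qed
  have Phi_rec: "?Phi r n = ?lam r n + (\<Sum>q\<le>n. P_coef pc j 0 q *v ?Phi r (n - q))" if "r \<le> k" for r n
    unfolding Phi_eq[OF that] by (rule resolvent_series_recursion) (rule U_coef_recursion[OF inv P_coef_0])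
  \<comment> \<open>Orders: \<open>p(m)\<close> and \<open>\<phi>(r - m)\<close> are known up to \<open>k - m\<close> and \<open>k - (r - m)\<close>, and both are at least
    \<open>k - r\<close>.\<close>
  have f_expands: "real_expands (\<lambda>\<epsilon>. f \<epsilon> i r) (\<lambda>n. ?Phi r n $ i) (k - r)" if "r \<le> k" for r i
    using that
  proof (induction r arbitrary: i rule: less_induct)
    case (less r)
    have lower: "real_expands (\<lambda>\<epsilon>. p \<epsilon> i l m * f \<epsilon> l (r - m))
        (\<lambda>n. \<Sum>q\<le>n. pc i (Some l) m q * ?Phi (r - m) (n - q) $ l) (k - r)" if "m \<in> {1..r}" for i l m
      using that less.prems
      by (intro real_expands_mult real_expands_mono[OF p_expands] real_expands_mono[OF less.IH]) auto
    have y: "real_expands (\<lambda>\<epsilon>. y r \<epsilon> $ i) (\<lambda>n. ?lam r n $ i) (k - r)" for i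
    proof -
      have "real_expands (\<lambda>\<epsilon>. y r \<epsilon> $ i) (\<lambda>n. pc i (Some j) r n + (\<Sum>m=1..r. real (r choose m) *
          (\<Sum>l\<in>-{j}. \<Sum>q\<le>n. pc i (Some l) m q * ?Phi (r - m) (n - q) $ l))) (k - r)"
        unfolding y_def vec_lambda_beta
        by (intro real_expands_add p_expands real_expands_sum real_expands_cmult lower less.prems)
      moreover have "pc i (Some j) r n + (\<Sum>m=1..r. real (r choose m) *
          (\<Sum>l\<in>-{j}. \<Sum>q\<le>n. pc i (Some l) m q * ?Phi (r - m) (n - q) $ l)) = ?lam r n $ i" for n
        by (subst lambda_coef.simps, simp add: p_coef_def P_coef_def matrix_vector_mult_def mult_offdiag)
           (simp add: sum.swap[of _ "-{j}"])
      ultimately show ?thesis by simp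
    qed
    have "\<forall>\<^sub>F \<epsilon> in at_right 0. \<forall>m\<in>{..r}. \<forall>i l. p_mom (X \<epsilon>) (Some i) (Some l) \<rho> m < \<infinity>"
      using fin_p less.prems by (intro eventually_ball_finite) auto
    moreover have "\<forall>\<^sub>F \<epsilon> in at_right 0. \<epsilon> \<ge> (0::real)" by (auto simp: eventually_at_filter)
    ultimately have sys: "\<forall>\<^sub>F \<epsilon> in at_right 0. (\<chi> i. f \<epsilon> i r) = y r \<epsilon> + P_mat (X \<epsilon>) j \<rho> *v (\<chi> i. f \<epsilon> i r)"
      using fin_phi by eventually_elim (intro system, auto)
    have P_mat: "real_expands (\<lambda>\<epsilon>. P_mat (X \<epsilon>) j \<rho> $ i $ l) (\<lambda>n. P_coef pc j 0 n $ i $ l) (k - r)" for i l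
      using real_expands_mono[OF p_expands[of 0 i l], of "k - r"]
      by (cases "l = j") (simp_all add: P_mat_def P_coef_def p_def real_expands_def)
    have "real_expands (\<lambda>\<epsilon>. (\<chi> i. f \<epsilon> i r) $ i) (\<lambda>n. ?Phi r n $ i) (k - r)"
      by (rule real_expands_solution[OF sys P_mat y])
        (use inv P_coef_0 in simp, rule Phi_rec[OF less.prems])
    then show ?case by simp
  qed
  have "vec_expands (\<lambda>\<epsilon>. Phi_vec (X \<epsilon>) j \<rho> r) (?Phi r) (k - r)" if "r \<le> k" for r
    unfolding vec_expands_def expands_iff
    using fin_phi_0 f_expands[OF that] eventually_mono[OF fin_phi]
    by (auto simp: Phi_vec_def Phi_0 f_def)
  then show ?thesis by fastforce
qed

end
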